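(* Let $X$ be a real Lévy process which is not a compound Poisson process and such that $|X|$ is not a subordinator. Assume that for every $t>0$ the law of $X_t$ under $\mathbb{P}$ is absolutely continuous on $[0,\infty)$, with density $p_t(x)$, and that the Lévy measure of $X$ is absolutely continuous on $(0,\infty)$, with density $\nu(x)$. Let $f_t(x)$ be the density on $(0,\infty)$ of the law of $\overline X_t=\sup_{s\le t}X_s$ under $\mathbb{P}$. Assume that for every $r>0$ there exists $c(r)>0$ such that $\nu(y)\le c(r)\nu(x)$ for every $y>x>r$ and $\nu(x)\le c(r)\nu(2x)$ for every $x>r$. Assume moreover that there exists $x_0>0$ such that $\lim_{x\to\infty}\nu(x+a)/\nu(x)=1$ for every $a>x_0$. Let $t_0>0$. If $$\lim_{x\to\infty}\frac{p_t(x)}{t\,\nu(x)}=1\quad\text{uniformly for } t\in(0,t_0],$$ then $$\lim_{x\to\infty}\frac{f_t(x)}{\nu(x)}=t\quad\text{uniformly for } t\in(0,t_0].$$ Moreover, if in addition $\nu$ is non-increasing on $(x^*,\infty)$ for some $x^*>0$, then $$\lim_{x\to\infty}\frac{f_t(x)}{t\,\nu(x)}=1\quad\text{uniformly for } t\in(0,t_0].$$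
   Context: Under $\mathbb{P}$ the process $X$ is a càdlàg real Lévy process started at $0$. Absolute continuity is with respect to Lebesgue measure on the indicated set. It is known that, under the stated absolute continuity of the laws of $X_t$ on $[0,\infty)$, the law of $\overline X_t$ is absolutely continuous on $(0,\infty)$ (it may have an atom at $0$), so that $f_t$ exists. *)

theory Defs
  imports "HOL-Probability.Probability"
begin

definition cadlag :: "(real \<Rightarrow> real) \<Rightarrow> bool" where
  "cadlag w \<longleftrightarrow>
     (\<forall>t\<ge>0. (w \<longlongrightarrow> w t) (at_right t)) \<and>
     (\<forall>t>0. \<exists>l. (w \<longlongrightarrow> l) (at_left t))"

text \<open>Only the times \<open>t \<ge> 0\<close> matter; the values of \<open>X\<close> at negative times are unconstrained.\<close>

locale levy_process = prob_space M for M :: "'a measure" +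
  fixes X :: "real \<Rightarrow> 'a \<Rightarrow> real"
  assumes random_variable_X: "\<And>t. 0 \<le> t \<Longrightarrow> random_variable borel (X t)"
    and cadlag_paths: "\<And>\<omega>. \<omega> \<in> space M \<Longrightarrow> cadlag (\<lambda>t. X t \<omega>)"
    and start_0: "AE \<omega> in M. X 0 \<omega> = 0"
    and indep_increments:
      "\<And>(\<tau> :: nat \<Rightarrow> real) n. 0 \<le> \<tau> 0 \<Longrightarrow> incseq \<tau> \<Longrightarrow>
         indep_vars (\<lambda>_. borel) (\<lambda>i \<omega>. X (\<tau> (Suc i)) \<omega> - X (\<tau> i) \<omega>) {..<n}"
    and stationary_increments:
      "\<And>s h. 0 \<le> s \<Longrightarrow> 0 \<le> h \<Longrightarrow>
         distr M borel (\<lambda>\<omega>. X (s + h) \<omega> - X s \<omega>) = distr M borel (X h)"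

definition subordinator :: "'a measure \<Rightarrow> (real \<Rightarrow> 'a \<Rightarrow> real) \<Rightarrow> bool" where
  "subordinator M X \<longleftrightarrow>
     levy_process M X \<and> (AE \<omega> in M. mono_on {0..} (\<lambda>t. X t \<omega>))"

definition poisson_process :: "'a measure \<Rightarrow> real \<Rightarrow> (real \<Rightarrow> 'a \<Rightarrow> nat) \<Rightarrow> bool" where
  "poisson_process M c N \<longleftrightarrow>
     levy_process M (\<lambda>t \<omega>. real (N t \<omega>)) \<and>
     (\<forall>t>0. distr M (count_space UNIV) (N t) = measure_pmf (poisson_pmf (c * t)))"

text \<open>
  \<open>X t = Y 0 + \<dots> + Y (N t - 1)\<close> for a Poisson process \<open>N\<close> and an i.i.d. sequence \<open>Y\<close> which is
  independent of \<open>N\<close>. The variables \<open>Y k\<close> may have an atom at \<open>0\<close>; up to a change of the rate this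
  adds only the null process, whose modulus is a subordinator.
\<close>

definition compound_poisson_process :: "'a measure \<Rightarrow> (real \<Rightarrow> 'a \<Rightarrow> real) \<Rightarrow> bool" where
  "compound_poisson_process M X \<longleftrightarrow>
     levy_process M X \<and>
     (\<exists>c>0. \<exists>(N :: real \<Rightarrow> 'a \<Rightarrow> nat) (Y :: nat \<Rightarrow> 'a \<Rightarrow> real).
        poisson_process M c N \<and>
        prob_space.indep_vars M (\<lambda>_. borel) Y UNIV \<and>
        (\<forall>k. distr M borel (Y k) = distr M borel (Y 0)) \<and>
        prob_space.indep_var M
          (Pi\<^sub>M {0..} (\<lambda>_. count_space UNIV)) (\<lambda>\<omega>. \<lambda>t\<in>{0..}. N t \<omega>)
          (Pi\<^sub>M UNIV (\<lambda>_. borel)) (\<lambda>\<omega> k. Y k \<omega>) \<and>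
        (AE \<omega> in M. \<forall>t\<ge>0. X t \<omega> = (\<Sum>k<N t \<omega>. Y k \<omega>)))"

text \<open>
  The Levy measure is the measure of the Levy-Khintchine triplet: drift \<open>b\<close>, Gaussian variance \<open>q\<close>
  and jump measure \<open>L\<close>, with truncation function \<open>x\<close> on \<open>(-1,1)\<close>. Neither the existence of \<open>L\<close>
  nor the measure itself depends on the truncation.
\<close>

definition levy_exponent :: "real \<Rightarrow> real \<Rightarrow> real measure \<Rightarrow> real \<Rightarrow> complex" where
  "levy_exponent b q L u =
     \<i> * complex_of_real (b * u) - complex_of_real (q * u\<^sup>2 / 2) +
     (CLINT x|L. iexp (u * x) - 1 - \<i> * complex_of_real (u * x * indicator {-1<..<1} x))"

definition is_levy_measure :: "'a measure \<Rightarrow> (real \<Rightarrow> 'a \<Rightarrow> real) \<Rightarrow> real measure \<Rightarrow> bool" where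
  "is_levy_measure M X L \<longleftrightarrow>
     sets L = sets borel \<and>
     emeasure L {0} = 0 \<and>
     (\<integral>\<^sup>+x. ennreal (min 1 (x\<^sup>2)) \<partial>L) < \<infinity> \<and>
     (\<exists>b q. 0 \<le> q \<and>
        (\<forall>t\<ge>0. \<forall>u. char (distr M borel (X t)) u =
                     exp (complex_of_real t * levy_exponent b q L u)))"

text \<open>
  The restriction of \<open>\<mu>\<close> to the Borel set \<open>S\<close> is absolutely continuous with respect to Lebesgue
  measure, with (a version of) the density \<open>g\<close>. The values of \<open>g\<close> outside \<open>S\<close> are irrelevant.
\<close>

definition has_density_on :: "real measure \<Rightarrow> real set \<Rightarrow> (real \<Rightarrow> real) \<Rightarrow> bool" where
  "has_density_on \<mu> S g \<longleftrightarrow>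
     set_borel_measurable borel S g \<and>
     (\<forall>x\<in>S. 0 \<le> g x) \<and>
     (\<forall>A\<in>sets borel. A \<subseteq> S \<longrightarrow> emeasure \<mu> A = (\<integral>\<^sup>+x\<in>A. ennreal (g x) \<partial>lborel))"

definition running_sup :: "(real \<Rightarrow> 'a \<Rightarrow> real) \<Rightarrow> real \<Rightarrow> 'a \<Rightarrow> real" where
  "running_sup X t \<omega> = (SUP s\<in>{0..t}. X s \<omega>)"

end

(*
  On the grid h = t / n the supremum of X has the law of the Lindley chain W (m + 1) = max 0 (W m
  + xi) started at 0, with steps xi distributed as X h. Fix a high level z. The chain reaches a
  set A far to the right essentially only by one jump from [0, z] to the vicinity of A. Since p_h
  ~ h nu uniformly in h, each of the n steps contributes h nu(A), because nu is long-tailed and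
  the remaining path moves by O(1) only. An entrance into (z, oo) that stays below A has small
  probability, and from there A is reached with probability O(t nu(A)), by the asymptotics of p_s
  and the doubling property, or through a return to 0, which is absorbed by a self-bounding
  estimate. All bounds are uniform in n and relative to t nu(A), which gives the second limit and
  hence the first. The limit n -> oo uses open sets for the upper and closed sets for the lower
  bound, and regularity of finite measures turns both into almost everywhere bounds on the
  density.
*)
theory Submission
  imports Defs
begin

section \<open>Uniform convergence for long-tailed functions\<close>

text \<open>The limits concern a density, so the target A may be arbitrarily small and no additive
  error is tolerable: a path that avoids the single big jump cannot be discarded merely because it
  is rare, it must still be charged with a probability of order \<open>t * \<nu>(A)\<close> of
  reaching A later. From a state between z and half the distance to A this charge comes from the law
  of the walk. After a return to 0 nothing is known in advance: the chain starts afresh, and the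
  largest hitting probability c over at most n steps reappears on the right, with the small crossing
  probability d as its factor. As c is finite, being at most 1, the inequality
  \<open>c \<le> (D + c) * d + n * E\<close> can be solved for c, and the result is proportional to
  \<nu>(A) because D and E are. The big jump starts at some y in [0, z] and is followed by a
  displacement s, so \<nu> is compared at points differing by y + s, which is at most 2 z in modulus
  unless s is large. Hence the limit of \<nu>(x + a) / \<nu>(x) is needed uniformly over bounded
  shifts a.\<close>

lemma ratio_shift_tendsto:
  fixes \<nu> :: "real \<Rightarrow> real"
  assumes lim: "\<And>a. x0 < a \<Longrightarrow> ((\<lambda>x. \<nu> (x + a) / \<nu> x) \<longlongrightarrow> 1) at_top"
  shows "((\<lambda>x. \<nu> (x + a) / \<nu> x) \<longlongrightarrow> 1) at_top"
proof -
  \<comment> \<open>Starting from \<open>x - b\<close>, the shift b leads to x and the shift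
    \<open>a + b\<close> to \<open>x + a\<close>; both shifts exceed \<open>x0\<close>, even for
    negative a.\<close>
  define b where "b = \<bar>x0\<bar> + \<bar>a\<bar> + 1"
  have b: "x0 < b" "x0 < a + b" by (auto simp: b_def)
  define q where "q y = (\<nu> (y + (a + b)) / \<nu> y) / (\<nu> (y + b) / \<nu> y)" for y
  have "(q \<longlongrightarrow> 1 / 1) at_top"
    unfolding q_def by (intro tendsto_divide lim b) auto
  moreover have shift: "filterlim (\<lambda>x. -b + x) at_top at_top"
    by (intro filterlim_tendsto_add_at_top[OF tendsto_const] filterlim_ident)
  ultimately have "((\<lambda>x. q (-b + x)) \<longlongrightarrow> 1 / 1) at_top"
    by (rule filterlim_compose)
  \<comment> \<open>Division by 0 yields 0, so a ratio above 1/2 shows that both values are nonzero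
    and that the double fraction may be cancelled.\<close>
  moreover have "eventually (\<lambda>y. \<nu> (y + b) / \<nu> y > 1 / 2) at_top"
    by (rule order_tendstoD(1)[OF lim[OF b(1)]]) auto
  then have "eventually (\<lambda>x. \<nu> ((-b + x) + b) / \<nu> (-b + x) > 1 / 2) at_top"
    using shift by (rule eventually_compose_filterlim)
  then have "eventually (\<lambda>x. q (-b + x) = \<nu> (x + a) / \<nu> x) at_top"
  proof eventually_elim
    case (elim x)
    then have "\<nu> (-b + x) \<noteq> 0" "\<nu> x \<noteq> 0" by auto
    then show ?case by (simp add: q_def algebra_simps)
  qed
  ultimately show ?thesis
    using tendsto_cong by force
qed

text \<open>
  The uniform convergence theorem for slowly varying functions. If \<open>g (x + a) - g x \<rightarrow> 0\<close> for every
  \<open>a\<close>, then \<open>\<psi> x\<close>, the integral of \<open>min 1 \<bar>g (x + u) - g x\<bar>\<close> over \<open>0 \<le> u \<le> 2 R\<close>, tends to \<open>0\<close>, and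
  comparing both values with \<open>g (x + u)\<close> for \<open>R \<le> u \<le> 2 R\<close> gives
  \<open>R * min 1 \<bar>g (x + a) - g x\<bar> \<le> \<psi> x + \<psi> (x + a)\<close> for \<open>0 \<le> a \<le> R\<close>.
\<close>

lemma uniform_shift_difference:
  fixes g :: "real \<Rightarrow> real"
  assumes [measurable]: "g \<in> borel_measurable borel"
    and lim: "\<And>a. ((\<lambda>x. g (x + a) - g x) \<longlongrightarrow> 0) at_top"
    and "0 < R" "0 < e"
  shows "\<exists>K. \<forall>x\<ge>K. \<forall>a. \<bar>a\<bar> \<le> R \<longrightarrow> \<bar>g (x + a) - g x\<bar> < e"
proof -
  define D where "D x u = indicator {0..2 * R} u * min 1 \<bar>g (x + u) - g x\<bar>" for x u
  define \<psi> where "\<psi> x = (\<integral>u. D x u \<partial>lborel)" for x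
  have D_meas [measurable]: "D x \<in> borel_measurable borel" for x
    unfolding D_def by measurable
  have D_le: "norm (D x u) \<le> indicator {0..2 * R} u" for x u
    by (auto simp: D_def indicator_def)
  have intI: "integrable lborel (\<lambda>u. indicator {0..2 * R} u :: real)"
    by (rule integrable_real_indicator) (auto simp: emeasure_lborel_Icc_eq)
  have D_int: "integrable lborel (D x)" for x
    by (rule Bochner_Integration.integrable_bound[OF intI])
      (use D_le in \<open>auto simp: D_def indicator_def\<close>)
  have "((\<lambda>x. integral\<^sup>L lborel (D x)) \<longlongrightarrow> integral\<^sup>L lborel (\<lambda>_ :: real. 0 :: real)) at_top"
  proof (rule integral_dominated_convergence_at_top[where w = "indicator {0..2 * R}"])
    show "AE u in lborel. ((\<lambda>x. D x u) \<longlongrightarrow> 0) at_top"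
    proof (rule AE_I2)
      fix u
      have "((\<lambda>x. indicator {0..2 * R} u * min 1 \<bar>g (x + u) - g x\<bar>) \<longlongrightarrow>
          indicator {0..2 * R} u * min 1 \<bar>0\<bar>) at_top"
        by (intro tendsto_intros lim)
      then show "((\<lambda>x. D x u) \<longlongrightarrow> 0) at_top" by (simp add: D_def)
    qed
  qed (use D_le intI in auto)
  then have "(\<psi> \<longlongrightarrow> 0) at_top" by (simp add: \<psi>_def[abs_def])
  \<comment> \<open>With d at most 1, a truncated value \<open>min 1 r < d\<close> forces
    \<open>r < d\<close>.\<close>
  define d where "d = min 1 e"
  have d: "0 < d" "d \<le> 1" "d \<le> e" using \<open>0 < e\<close> by (auto simp: d_def)
  have "eventually (\<lambda>x. \<psi> x < R * d / 2) at_top"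
    using \<open>(\<psi> \<longlongrightarrow> 0) at_top\<close> d \<open>0 < R\<close> by (intro order_tendstoD(2)) auto
  then obtain K where K: "\<And>x. K \<le> x \<Longrightarrow> \<psi> x < R * d / 2"
    by (auto simp: eventually_at_top_linorder)
  have main: "\<bar>g (x + a) - g x\<bar> < d" if "K \<le> x" "0 \<le> a" "a \<le> R" for x a
  proof -
    have shift: "integrable lborel (\<lambda>u. D (x + a) (-a + 1 * u))"
      "\<psi> (x + a) = (\<integral>u. D (x + a) (-a + 1 * u) \<partial>lborel)"
      using lborel_integrable_real_affine[OF D_int, of 1 "x + a" "-a"]
        lborel_integral_real_affine[of 1 "D (x + a)" "-a"]
      by (auto simp: \<psi>_def)
    have "R * min 1 \<bar>g (x + a) - g x\<bar>
        = (\<integral>u. indicator {R..2 * R} u * min 1 \<bar>g (x + a) - g x\<bar> \<partial>lborel)"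
      using \<open>0 < R\<close> by simp
    also have "\<dots> \<le> (\<integral>u. D x u + D (x + a) (-a + 1 * u) \<partial>lborel)"
    proof (rule integral_mono)
      show "integrable lborel (\<lambda>u. indicator {R..2 * R} u * min 1 \<bar>g (x + a) - g x\<bar>)"
        by (intro integrable_mult_left integrable_real_indicator) (auto simp: emeasure_lborel_Icc_eq)
      show "integrable lborel (\<lambda>u. D x u + D (x + a) (-a + 1 * u))"
        by (intro Bochner_Integration.integrable_add D_int shift)
      show "indicator {R..2 * R} u * min 1 \<bar>g (x + a) - g x\<bar> \<le> D x u + D (x + a) (-a + 1 * u)" for u
        using that \<open>0 < R\<close> by (auto simp: D_def indicator_def)
    qed
    also have "\<dots> = \<psi> x + \<psi> (x + a)"
      unfolding shift(2) by (subst Bochner_Integration.integral_add[OF D_int shift(1)]) (simp add: \<psi>_def)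
    also have "\<dots> < R * d"
      using K[of x] K[of "x + a"] that by simp
    finally have "min 1 \<bar>g (x + a) - g x\<bar> < d" using \<open>0 < R\<close> by simp
    then show ?thesis using d by auto
  qed
  show ?thesis
  \<comment> \<open>A negative shift a at x is the positive shift -a at \<open>x + a\<close>, which
    still lies above K.\<close>
  proof (intro exI[of _ "K + R"] allI impI)
    fix x a :: real assume "K + R \<le> x" "\<bar>a\<bar> \<le> R"
    then show "\<bar>g (x + a) - g x\<bar> < e"
      using main[of x a] main[of "x + a" "-a"] d(3) by (cases "0 \<le> a") auto
  qed
qed

text \<open>Logarithms turn ratios into the differences of \<open>uniform_shift_difference\<close>;
  the accuracy \<open>ln (1 + e)\<close> is then the factor \<open>1 + e\<close>.\<close>

lemma uniform_shift_ratio: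
  fixes \<nu> :: "real \<Rightarrow> real"
  assumes [measurable]: "\<nu> \<in> borel_measurable borel"
    and nonneg: "\<And>x. 0 \<le> \<nu> x"
    and lim: "\<And>a. x0 < a \<Longrightarrow> ((\<lambda>x. \<nu> (x + a) / \<nu> x) \<longlongrightarrow> 1) at_top"
    and "0 < R" "0 < e"
  shows "\<exists>K. \<forall>x\<ge>K. 0 < \<nu> x \<and>
    (\<forall>a. \<bar>a\<bar> \<le> R \<longrightarrow> (1 - e) * \<nu> x \<le> \<nu> (x + a) \<and> \<nu> (x + a) \<le> (1 + e) * \<nu> x)"
proof -
  have lim': "((\<lambda>x. \<nu> (x + a) / \<nu> x) \<longlongrightarrow> 1) at_top" for a
    using lim by (rule ratio_shift_tendsto)
  \<comment> \<open>At shift 0 the ratio is 1, or 0 where \<nu> vanishes; exceeding 1/2 therefore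
    means positivity.\<close>
  have "eventually (\<lambda>x. \<nu> (x + 0) / \<nu> x > 1 / 2) at_top"
    by (rule order_tendstoD(1)[OF lim']) auto
  then have "eventually (\<lambda>x. 0 < \<nu> x) at_top"
    by eventually_elim (use nonneg in \<open>auto simp: order_less_le split: if_splits\<close>)
  then obtain K1 where K1: "\<And>x. K1 \<le> x \<Longrightarrow> 0 < \<nu> x"
    by (auto simp: eventually_at_top_linorder)
  have "((\<lambda>x. ln (\<nu> (x + a)) - ln (\<nu> x)) \<longlongrightarrow> 0) at_top" for a
  proof -
    have "((\<lambda>x. ln (\<nu> (x + a) / \<nu> x)) \<longlongrightarrow> ln 1) at_top"
      by (intro tendsto_ln lim') auto
    moreover have "eventually (\<lambda>x. ln (\<nu> (x + a) / \<nu> x) = ln (\<nu> (x + a)) - ln (\<nu> x)) at_top"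
      using eventually_ge_at_top[of "K1 + \<bar>a\<bar>"]
    proof eventually_elim
      case (elim x)
      have "0 < \<nu> (x + a)" "0 < \<nu> x"
        by (rule K1; use elim in linarith)+
      then show ?case by (simp add: ln_div)
    qed
    ultimately show ?thesis using tendsto_cong by force
  qed
  then obtain K2 where K2: "\<And>x a. K2 \<le> x \<Longrightarrow> \<bar>a\<bar> \<le> R \<Longrightarrow> \<bar>ln (\<nu> (x + a)) - ln (\<nu> x)\<bar> < ln (1 + e)"
    using uniform_shift_difference[of "\<lambda>x. ln (\<nu> x)" R "ln (1 + e)"] \<open>0 < R\<close> \<open>0 < e\<close> by auto
  show ?thesis
  proof (intro exI[of _ "max K2 (K1 + R)"] allI impI conjI)
    fix x assume x: "max K2 (K1 + R) \<le> x"
    show pos: "0 < \<nu> x" using x \<open>0 < R\<close> by (intro K1) auto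
    fix a assume a: "\<bar>a\<bar> \<le> R"
    have pos': "0 < \<nu> (x + a)" using x a by (intro K1) auto
    \<comment> \<open>The bound on the logarithms is symmetric in x and \<open>x + a\<close>. It
      gives an upper bound in both directions, and the lower bound follows from
      \<open>(1 - e) * (1 + e) \<le> 1\<close>.\<close>
    have "ln (\<nu> (x + a)) \<le> ln ((1 + e) * \<nu> x)" "ln (\<nu> x) \<le> ln ((1 + e) * \<nu> (x + a))"
      using K2[of x a] x a pos pos' \<open>0 < e\<close> by (auto simp: ln_mult)
    then have *: "\<nu> (x + a) \<le> (1 + e) * \<nu> x" "\<nu> x \<le> (1 + e) * \<nu> (x + a)"
      using pos pos' \<open>0 < e\<close> by (auto simp: mult_pos_pos)
    show "\<nu> (x + a) \<le> (1 + e) * \<nu> x" by fact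
    show "(1 - e) * \<nu> x \<le> \<nu> (x + a)"
    proof (cases "e \<le> 1")
      case True
      then have "(1 - e) * \<nu> x \<le> (1 - e) * ((1 + e) * \<nu> (x + a))"
        using * by (intro mult_left_mono) auto
      also have "\<dots> = \<nu> (x + a) - e\<^sup>2 * \<nu> (x + a)" by (simp add: algebra_simps power2_eq_square)
      also have "\<dots> \<le> \<nu> (x + a)" using pos' by simp
      finally show ?thesis .
    next
      case False
      then have "(1 - e) * \<nu> x \<le> 0" using pos by (intro mult_nonpos_nonneg) auto
      then show ?thesis using pos' by linarith
    qed
  qed
qed

section \<open>Lindley chains\<close>

text \<open>The m-th power of the Markov operator with update T and step law \<mu>, applied to
  \<phi>: the expectation of \<phi> at the state after m independent steps from y. The backward form
  conditions on the next step, so path decompositions become inductions on m.\<close>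

primrec chain ::
  "(real \<Rightarrow> real \<Rightarrow> real) \<Rightarrow> real measure \<Rightarrow> nat \<Rightarrow> (real \<Rightarrow> ennreal) \<Rightarrow> real \<Rightarrow> ennreal" where
  "chain T \<mu> 0 \<phi> y = \<phi> y"
| "chain T \<mu> (Suc m) \<phi> y = (\<integral>\<^sup>+ \<xi>. chain T \<mu> m \<phi> (T y \<xi>) \<partial>\<mu>)"

text \<open>The steps are consumed in the order \<open>x (m - 1), \<dots>, x 0\<close>, so that the supremum of a random
  walk appears as the state of the Lindley chain driven by the increments of the walk.\<close>

primrec chain_state :: "(real \<Rightarrow> real \<Rightarrow> real) \<Rightarrow> nat \<Rightarrow> (nat \<Rightarrow> real) \<Rightarrow> real \<Rightarrow> real" where
  "chain_state T 0 x y = y"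
| "chain_state T (Suc m) x y = chain_state T m x (T y (x m))"

lemma measurable_chain [measurable (raw)]:
  assumes "case_prod T \<in> borel_measurable (borel \<Otimes>\<^sub>M borel)" "sets \<mu> = sets borel" "prob_space \<mu>"
    and "\<phi> \<in> borel_measurable borel" and g: "g \<in> borel_measurable N"
  shows "(\<lambda>w. chain T \<mu> m \<phi> (g w)) \<in> borel_measurable N"
proof -
  interpret prob_space \<mu> by fact
  note [measurable] = assms(1,4)
  note [measurable_cong] = assms(2)
  have "chain T \<mu> m \<phi> \<in> borel_measurable borel"
  proof (induction m)
    case 0
    then show ?case by (simp add: assms(4))
  next
    case (Suc m)
    note [measurable] = Suc.IH
    show ?case
      unfolding chain.simps[abs_def] by measurable
  qed
  then show ?thesis using g by measurable
qed

lemma measurable_chain_state [measurable (raw)]: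
  assumes [measurable]: "case_prod T \<in> borel_measurable (borel \<Otimes>\<^sub>M borel)"
    and x: "\<And>i. i < m \<Longrightarrow> (\<lambda>w. x w i) \<in> borel_measurable N"
    and "g \<in> borel_measurable N"
  shows "(\<lambda>w. chain_state T m (x w) (g w)) \<in> borel_measurable N"
  using x \<open>g \<in> borel_measurable N\<close>
proof (induction m arbitrary: g)
  case (Suc m)
  note [measurable] = Suc.prems(2) Suc.prems(1)[OF lessI]
  have "(\<lambda>w. T (g w) (x w m)) \<in> borel_measurable N" by measurable
  with Suc show ?case by simp
qed simp

lemma nn_integral_chain_state:
  assumes [measurable]: "case_prod T \<in> borel_measurable (borel \<Otimes>\<^sub>M borel)"
    and [measurable_cong]: "sets \<mu> = sets borel" and \<mu>: "prob_space \<mu>"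
    and [measurable]: "\<phi> \<in> borel_measurable borel"
  shows "(\<integral>\<^sup>+ x. \<phi> (chain_state T m x y) \<partial>Pi\<^sub>M {..<m} (\<lambda>_. \<mu>)) = chain T \<mu> m \<phi> y"
proof (induction m arbitrary: y)
  case 0
  interpret prob_space "Pi\<^sub>M {} (\<lambda>_::nat. \<mu>)" using \<mu> by (intro prob_space_PiM)
  show ?case by (simp add: emeasure_space_1)
next
  case (Suc m)
  interpret prob_space \<mu> by fact
  interpret product_sigma_finite "\<lambda>_::nat. \<mu>" ..
  have [measurable]: "(\<lambda>x. chain_state T (Suc m) x y) \<in> borel_measurable (Pi\<^sub>M {..<Suc m} (\<lambda>_. \<mu>))"
  proof (rule measurable_chain_state)
    fix i assume "i < Suc m"
    then have "(\<lambda>w. w i) \<in> measurable (Pi\<^sub>M {..<Suc m} (\<lambda>_. \<mu>)) \<mu>"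
      by (simp add: measurable_component_singleton)
    then show "(\<lambda>w. w i) \<in> borel_measurable (Pi\<^sub>M {..<Suc m} (\<lambda>_. \<mu>))"
      by (simp add: measurable_cong_sets[OF refl assms(2)])
  qed auto
  \<comment> \<open>Coordinate m is consumed first; the remaining m steps read only smaller
    coordinates.\<close>
  have upd: "chain_state T k (x(m := \<xi>)) w = chain_state T k x w" if "k \<le> m" for k x \<xi> w
    using that by (induction k arbitrary: w) auto
  have "(\<integral>\<^sup>+ x. \<phi> (chain_state T (Suc m) x y) \<partial>Pi\<^sub>M {..<Suc m} (\<lambda>_. \<mu>))
      = (\<integral>\<^sup>+ \<xi>. \<integral>\<^sup>+ x. \<phi> (chain_state T (Suc m) (x(m := \<xi>)) y) \<partial>Pi\<^sub>M {..<m} (\<lambda>_. \<mu>) \<partial>\<mu>)"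
    unfolding lessThan_Suc by (intro product_nn_integral_insert_rev) (auto simp flip: lessThan_Suc)
  also have "\<dots> = chain T \<mu> (Suc m) \<phi> y"
    by (simp add: upd Suc.IH)
  finally show ?case .
qed

context
  fixes \<mu> :: "real measure" and T :: "real \<Rightarrow> real \<Rightarrow> real"
  assumes \<mu>: "prob_space \<mu>" and sets_\<mu> [measurable_cong]: "sets \<mu> = sets borel"
    and T [measurable]: "case_prod T \<in> borel_measurable (borel \<Otimes>\<^sub>M borel)"
begin

lemma chain_const: "chain T \<mu> m (\<lambda>_. c) y = c"
  using prob_space.emeasure_space_1[OF \<mu>] by (induction m arbitrary: y) auto

lemma chain_mono: "(\<And>x. \<phi> x \<le> \<psi> x) \<Longrightarrow> chain T \<mu> m \<phi> y \<le> chain T \<mu> m \<psi> y"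
  by (induction m arbitrary: y) (auto intro!: nn_integral_mono)

lemma chain_le_1: "(\<And>x. \<phi> x \<le> 1) \<Longrightarrow> chain T \<mu> m \<phi> y \<le> 1"
  using chain_mono[of \<phi> "\<lambda>_. 1" m y] by (simp add: chain_const)

lemma chain_add:
  assumes [measurable]: "\<phi> \<in> borel_measurable borel" "\<psi> \<in> borel_measurable borel"
  shows "chain T \<mu> m (\<lambda>x. \<phi> x + \<psi> x) y = chain T \<mu> m \<phi> y + chain T \<mu> m \<psi> y"
proof (induction m arbitrary: y)
  case (Suc m)
  note [simp] = sets_\<mu> \<mu>
  have "(\<lambda>\<xi>. chain T \<mu> m \<phi> (T y \<xi>)) \<in> borel_measurable \<mu>" "(\<lambda>\<xi>. chain T \<mu> m \<psi> (T y \<xi>)) \<in> borel_measurable \<mu>"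
    by measurable
  then show ?case by (simp add: Suc nn_integral_add)
qed simp

end

definition lindley :: "real \<Rightarrow> real \<Rightarrow> real" where
  "lindley y \<xi> = max 0 (y + \<xi>)"

text \<open>Freezing the chain once it exceeds z turns events about the whole path into events about
  the last state: with \<open>indicator {z<..}\<close> the chain gives the probability of an
  entrance into (z, \<infinity>) within m steps, with \<open>indicator {..z}\<close> that of
  none.\<close>

definition absorbed_lindley :: "real \<Rightarrow> real \<Rightarrow> real \<Rightarrow> real" where
  "absorbed_lindley z y \<xi> = (if z < y then y else lindley y \<xi>)"

lemma measurable_lindley [measurable]: "case_prod lindley \<in> borel_measurable (borel \<Otimes>\<^sub>M borel)"
  unfolding lindley_def[abs_def] by measurable

lemma measurable_absorbed_lindley [measurable]:
  "case_prod (absorbed_lindley z) \<in> borel_measurable (borel \<Otimes>\<^sub>M borel)"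
  unfolding absorbed_lindley_def[abs_def] by measurable

lemma measurable_walk [measurable]: "case_prod ((+) :: real \<Rightarrow> real \<Rightarrow> real) \<in> borel_measurable (borel \<Otimes>\<^sub>M borel)"
  by measurable

lemma lindley_nonneg [simp]: "0 \<le> lindley y \<xi>"
  and lindley_eq_add: "0 \<le> y + \<xi> \<Longrightarrow> lindley y \<xi> = y + \<xi>"
  and lindley_eq_0: "y + \<xi> < 0 \<Longrightarrow> lindley y \<xi> = 0"
  by (simp_all add: lindley_def)

context
  fixes \<mu> :: "real measure"
  assumes \<mu> [simp]: "prob_space \<mu>" and sets_\<mu> [measurable_cong, simp]: "sets \<mu> = sets borel"
begin

lemma emeasure_space_eq_1 [simp]: "emeasure \<mu> (space \<mu>) = 1"
  by (simp add: prob_space.emeasure_space_1)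

lemma chain_absorbed: "z < y \<Longrightarrow> chain (absorbed_lindley z) \<mu> m \<phi> y = \<phi> y"
  by (induction m) (simp_all add: absorbed_lindley_def)

text \<open>Until the first reset the chain and the walk agree; at a reset the chain restarts from 0
  with fewer steps left, at a cost of at most c.\<close>

lemma lindley_le_walk:
  assumes [measurable]: "\<phi> \<in> borel_measurable borel"
    and "\<And>k. k < m \<Longrightarrow> chain lindley \<mu> k \<phi> 0 \<le> c" and "0 \<le> y"
  shows "chain lindley \<mu> m \<phi> y \<le> chain (+) \<mu> m \<phi> y + c"
  using assms(2,3)
proof (induction m arbitrary: y)
  case (Suc m)
  have "chain lindley \<mu> m \<phi> (lindley y \<xi>) \<le> chain (+) \<mu> m \<phi> (y + \<xi>) + c" for \<xi>
  proof (cases "0 \<le> y + \<xi>")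
    case True
    then show ?thesis using Suc.IH[of "y + \<xi>"] Suc.prems by (simp add: lindley_eq_add)
  next
    case False
    then show ?thesis using Suc.prems(1)[of m] by (simp add: lindley_eq_0 add_increasing)
  qed
  then have "chain lindley \<mu> (Suc m) \<phi> y \<le> (\<integral>\<^sup>+ \<xi>. chain (+) \<mu> m \<phi> (y + \<xi>) + c \<partial>\<mu>)"
    by (auto intro: nn_integral_mono)
  also have "\<dots> = chain (+) \<mu> (Suc m) \<phi> y + c"
    by (simp add: nn_integral_add)
  finally show ?case .
qed simp

text \<open>The converse comparison: chain and walk agree until the walk turns negative, and from
  there the walk contributes at most D.\<close>

lemma walk_le_lindley:
  assumes [measurable]: "\<phi> \<in> borel_measurable borel"
    and "\<And>k y. k < m \<Longrightarrow> y < 0 \<Longrightarrow> chain (+) \<mu> k \<phi> y \<le> D" and "0 \<le> y"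
  shows "chain (+) \<mu> m \<phi> y \<le> chain lindley \<mu> m \<phi> y + D"
  using assms(2,3)
proof (induction m arbitrary: y)
  case (Suc m)
  have "chain (+) \<mu> m \<phi> (y + \<xi>) \<le> chain lindley \<mu> m \<phi> (lindley y \<xi>) + D" for \<xi>
  proof (cases "0 \<le> y + \<xi>")
    case True
    then show ?thesis using Suc.IH[of "y + \<xi>"] Suc.prems by (simp add: lindley_eq_add)
  next
    case False
    then show ?thesis using Suc.prems(1)[of m "y + \<xi>"] by (simp add: lindley_eq_0 add_increasing)
  qed
  then have "chain (+) \<mu> (Suc m) \<phi> y \<le> (\<integral>\<^sup>+ \<xi>. chain lindley \<mu> m \<phi> (lindley y \<xi>) + D \<partial>\<mu>)"
    by (auto intro: nn_integral_mono)
  also have "\<dots> = chain lindley \<mu> (Suc m) \<phi> y + D"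
    by (simp add: nn_integral_add)
  finally show ?case .
qed simp

text \<open>Driven by the same steps, the chain stays above the walk, and a half-line to the right
  is upward closed.\<close>

lemma walk_tail_le_lindley_tail:
  "y \<le> y' \<Longrightarrow> chain (+) \<mu> m (indicator {r<..}) y \<le> chain lindley \<mu> m (indicator {r<..}) y'"
proof (induction m arbitrary: y y')
  case (Suc m)
  then show ?case by (auto intro!: nn_integral_mono Suc.IH simp: lindley_def)
qed (auto simp: indicator_def)

text \<open>An inequality of Ottaviani type. From the first state above z the walk ends above r with
  probability at least p, whatever number of steps is left, and the chain dominates the
  walk.\<close>

lemma crossing_le_lindley_tail:
  assumes "\<And>k y. k \<le> m \<Longrightarrow> z < y \<Longrightarrow> p \<le> chain (+) \<mu> k (indicator {r<..}) y"
  shows "p * chain (absorbed_lindley z) \<mu> m (indicator {z<..}) y \<le> chain lindley \<mu> m (indicator {r<..}) y"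
  using assms
proof (induction m arbitrary: y)
  case (Suc m)
  show ?case
  proof (cases "z < y")
    case True
    have "p \<le> chain lindley \<mu> (Suc m) (indicator {r<..}) y"
      using Suc.prems[OF le_refl True] walk_tail_le_lindley_tail[of y y "Suc m" r] by (meson order.trans order_refl)
    then show ?thesis using True by (subst chain_absorbed) auto
  next
    case False
    then have "p * chain (absorbed_lindley z) \<mu> (Suc m) (indicator {z<..}) y
        = (\<integral>\<^sup>+ \<xi>. p * chain (absorbed_lindley z) \<mu> m (indicator {z<..}) (lindley y \<xi>) \<partial>\<mu>)"
      by (simp add: absorbed_lindley_def nn_integral_cmult lindley_def)
    also have "\<dots> \<le> chain lindley \<mu> (Suc m) (indicator {r<..}) y"
      using Suc.prems by (auto intro!: nn_integral_mono Suc.IH)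
    finally show ?thesis .
  qed
next
  case 0
  show ?case using 0[of 0 y] by (cases "z < y") auto
qed

text \<open>
  Both bounds for the Lindley chain decompose a path at its first entrance into \<open>(z, \<infinity>)\<close>: a large
  entrance jump contributes \<open>e\<close> per time step, any other entrance is negligible.
\<close>

lemma lindley_upper:
  assumes [measurable]: "\<phi> \<in> borel_measurable borel"
    and "z < b"
    and \<phi>0: "\<And>y. 0 \<le> y \<Longrightarrow> y \<le> z \<Longrightarrow> \<phi> y = 0"
    and "\<And>k y. k < m \<Longrightarrow> z < y \<Longrightarrow> y < b \<Longrightarrow> chain (+) \<mu> k \<phi> y \<le> D"
    and "\<And>k. k < m \<Longrightarrow> chain lindley \<mu> k \<phi> 0 \<le> c"
    and "\<And>k y. k < m \<Longrightarrow> 0 \<le> y \<Longrightarrow> y \<le> z \<Longrightarrow>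
      (\<integral>\<^sup>+ \<xi>. indicator {b..} (y + \<xi>) * chain (+) \<mu> k \<phi> (y + \<xi>) \<partial>\<mu>) \<le> e"
    and "0 \<le> y" "y \<le> z"
  shows "chain lindley \<mu> m \<phi> y
    \<le> (D + c) * chain (absorbed_lindley z) \<mu> m (indicator {z<..}) y + of_nat m * e"
  using assms(4-)
proof (induction m arbitrary: y)
  case 0
  then show ?case by (simp add: \<phi>0)
next
  case (Suc m)
  let ?\<pi> = "chain (absorbed_lindley z) \<mu> m (indicator {z<..})"
  have *: "chain lindley \<mu> m \<phi> (lindley y \<xi>)
      \<le> ((D + c) * ?\<pi> (lindley y \<xi>) + of_nat m * e) + indicator {b..} (y + \<xi>) * chain (+) \<mu> m \<phi> (y + \<xi>)" for \<xi>
  proof (cases "lindley y \<xi> \<le> z")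
    case True
    have "chain lindley \<mu> m \<phi> (lindley y \<xi>) \<le> (D + c) * ?\<pi> (lindley y \<xi>) + of_nat m * e"
      using Suc.prems True by (intro Suc.IH) auto
    then show ?thesis by (simp add: add_increasing2)
  next
    case False
    then have w: "lindley y \<xi> = y + \<xi>" "z < y + \<xi>" "0 \<le> y + \<xi>"
      using Suc.prems(4,5) by (auto simp: lindley_def max_def split: if_splits)
    have \<pi>: "?\<pi> (y + \<xi>) = 1" using w(2) by (simp add: chain_absorbed)
    have le: "chain lindley \<mu> m \<phi> (y + \<xi>) \<le> chain (+) \<mu> m \<phi> (y + \<xi>) + c"
      using Suc.prems(2) w(3) by (intro lindley_le_walk) auto
    show ?thesis
    proof (cases "y + \<xi> < b")
      case True
      have "chain lindley \<mu> m \<phi> (y + \<xi>) \<le> D + c"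
        using le Suc.prems(1)[OF lessI w(2) True] by (meson add_right_mono order.trans)
      then show ?thesis using True by (simp add: w(1) \<pi> add_increasing2)
    next
      case False
      \<comment> \<open>Beyond b the crossing probability is 1 as well, so
        \<open>(D + c) * 1\<close> already covers the return term c and only the walk term has to be
        charged to e.\<close>
      have "chain (+) \<mu> m \<phi> (y + \<xi>) + c \<le> chain (+) \<mu> m \<phi> (y + \<xi>) + (D + c + of_nat m * e)"
        by (intro add_left_mono) (simp add: add.assoc add_increasing add_increasing2)
      then have "chain lindley \<mu> m \<phi> (y + \<xi>) \<le> (D + c + of_nat m * e) + chain (+) \<mu> m \<phi> (y + \<xi>)"
        using le by (auto simp: ac_simps elim: order.trans)
      then show ?thesis using False by (simp add: w(1) \<pi>)
    qed
  qed
  have "chain lindley \<mu> (Suc m) \<phi> y \<le> (\<integral>\<^sup>+ \<xi>. ((D + c) * ?\<pi> (lindley y \<xi>) + of_nat m * e) +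
      indicator {b..} (y + \<xi>) * chain (+) \<mu> m \<phi> (y + \<xi>) \<partial>\<mu>)"
    using * by (auto intro: nn_integral_mono)
  also have "\<dots> = (D + c) * (\<integral>\<^sup>+ \<xi>. ?\<pi> (lindley y \<xi>) \<partial>\<mu>) + of_nat m * e +
      (\<integral>\<^sup>+ \<xi>. indicator {b..} (y + \<xi>) * chain (+) \<mu> m \<phi> (y + \<xi>) \<partial>\<mu>)"
    by (simp add: nn_integral_add nn_integral_cmult lindley_def)
  also have "\<dots> \<le> (D + c) * (\<integral>\<^sup>+ \<xi>. ?\<pi> (lindley y \<xi>) \<partial>\<mu>) + of_nat m * e + e"
    using Suc.prems by (intro add_left_mono) auto
  also have "\<dots> = (D + c) * chain (absorbed_lindley z) \<mu> (Suc m) (indicator {z<..}) y + of_nat (Suc m) * e"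
    using Suc.prems by (simp add: absorbed_lindley_def algebra_simps)
  finally show ?case .
qed

lemma lindley_lower:
  assumes [measurable]: "\<phi> \<in> borel_measurable borel"
    and "z < b" "0 \<le> z"
    and "\<And>k y. k < m \<Longrightarrow> 0 \<le> y \<Longrightarrow> y \<le> z \<Longrightarrow>
      e \<le> (\<integral>\<^sup>+ \<xi>. indicator {b..} (y + \<xi>) * chain lindley \<mu> k \<phi> (y + \<xi>) \<partial>\<mu>)"
    and "0 \<le> y"
  shows "of_nat m * e * chain (absorbed_lindley z) \<mu> m (indicator {..z}) y \<le> chain lindley \<mu> m \<phi> y"
  using assms(4-)
proof (induction m arbitrary: y)
  case (Suc m)
  let ?\<sigma> = "\<lambda>m. chain (absorbed_lindley z) \<mu> m (indicator {..z})"
  show ?case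
  proof (cases "z < y")
    case True
    then show ?thesis by (subst chain_absorbed) auto
  next
    case False
    \<comment> \<open>A jump to or beyond b freezes the absorbed chain above z, so its survival term
      vanishes; the two summands on the left are never nonzero together.\<close>
    have *: "of_nat m * e * ?\<sigma> m (lindley y \<xi>) + indicator {b..} (y + \<xi>) * chain lindley \<mu> m \<phi> (y + \<xi>)
        \<le> chain lindley \<mu> m \<phi> (lindley y \<xi>)" for \<xi>
    proof (cases "b \<le> y + \<xi>")
      case True
      then have "z < lindley y \<xi>" "lindley y \<xi> = y + \<xi>"
        using \<open>z < b\<close> \<open>0 \<le> z\<close> by (auto simp: lindley_def)
      then show ?thesis by (simp add: chain_absorbed True)
    next
      case False
      then show ?thesis using Suc.prems by (simp add: Suc.IH)
    qed
    have "?\<sigma> (Suc m) y \<le> 1"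
      by (rule chain_le_1) (auto simp: indicator_def)
    then have "of_nat (Suc m) * e * ?\<sigma> (Suc m) y \<le> of_nat m * e * ?\<sigma> (Suc m) y + e"
      using mult_left_mono[of "?\<sigma> (Suc m) y" 1 e] by (simp add: algebra_simps)
    also have "\<dots> \<le> of_nat m * e * ?\<sigma> (Suc m) y +
        (\<integral>\<^sup>+ \<xi>. indicator {b..} (y + \<xi>) * chain lindley \<mu> m \<phi> (y + \<xi>) \<partial>\<mu>)"
      using Suc.prems False by (intro add_left_mono) auto
    also have "\<dots> = (\<integral>\<^sup>+ \<xi>. of_nat m * e * ?\<sigma> m (lindley y \<xi>) +
        indicator {b..} (y + \<xi>) * chain lindley \<mu> m \<phi> (y + \<xi>) \<partial>\<mu>)"
      using False
      by (simp add: nn_integral_add nn_integral_cmult absorbed_lindley_def lindley_def)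
    also have "\<dots> \<le> chain lindley \<mu> (Suc m) \<phi> y"
      using * by (auto intro: nn_integral_mono)
    finally show ?thesis .
  qed
qed simp

lemma survival_add_crossing:
  "chain (absorbed_lindley z) \<mu> m (indicator {..z}) y + chain (absorbed_lindley z) \<mu> m (indicator {z<..}) y = 1"
proof -
  have "chain (absorbed_lindley z) \<mu> m (indicator {..z}) y + chain (absorbed_lindley z) \<mu> m (indicator {z<..}) y
      = chain (absorbed_lindley z) \<mu> m (\<lambda>x. indicator {..z} x + indicator {z<..} x) y"
    by (intro chain_add[symmetric]) auto
  also have "(\<lambda>x. indicator {..z} x + indicator {z<..} x :: ennreal) = (\<lambda>_. 1)"
    by (auto simp: indicator_def fun_eq_iff)
  finally show ?thesis by (simp add: chain_const)
qed

end

section \<open>Chains with regular tails\<close>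

text \<open>What the grid estimate uses of the laws P t of X t. \<open>walk_eq\<close> says that m
  steps of law P h add up to the law P (m h), and \<open>tail\<close> is the statement p_t ~ t \<nu>
  tested against functions, which makes it independent of versions of the densities.\<close>

locale regular_tail_semigroup =
  fixes P :: "real \<Rightarrow> real measure" and \<nu> :: "real \<Rightarrow> real" and t0 :: real
  assumes t0: "0 < t0"
    and prob_P: "\<And>t. 0 \<le> t \<Longrightarrow> prob_space (P t)"
    and sets_P [simp, measurable_cong]: "\<And>t. sets (P t) = sets borel"
    and walk_eq: "\<And>h m \<phi> y. 0 < h \<Longrightarrow> \<phi> \<in> borel_measurable borel \<Longrightarrow>
      chain (+) (P h) m \<phi> y = (\<integral>\<^sup>+ s. \<phi> (y + s) \<partial>P (real m * h))"
    and tight: "\<And>d. 0 < d \<Longrightarrow> \<exists>z. \<forall>t\<in>{0..t0}. emeasure (P t) {x. z < \<bar>x\<bar>} \<le> ennreal d"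
    and lindley_tight: "\<And>d. 0 < d \<Longrightarrow> \<exists>z. \<forall>h m. 0 < h \<longrightarrow> real m * h \<le> t0 \<longrightarrow>
      chain lindley (P h) m (indicator {z<..}) 0 \<le> ennreal d"
    and \<nu>_meas [measurable]: "\<nu> \<in> borel_measurable borel"
    and \<nu>_nonneg: "\<And>x. 0 \<le> \<nu> x"
    and tail: "\<And>d. 0 < d \<Longrightarrow> \<exists>K. \<forall>t\<in>{0<..t0}. \<forall>\<phi>\<in>borel_measurable borel. (\<forall>x\<le>K. \<phi> x = 0) \<longrightarrow>
      ennreal ((1 - d) * t) * (\<integral>\<^sup>+ x. \<phi> x * ennreal (\<nu> x) \<partial>lborel) \<le> (\<integral>\<^sup>+ x. \<phi> x \<partial>P t) \<and>
      (\<integral>\<^sup>+ x. \<phi> x \<partial>P t) \<le> ennreal ((1 + d) * t) * (\<integral>\<^sup>+ x. \<phi> x * ennreal (\<nu> x) \<partial>lborel)"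
    and long_tail: "\<And>R d. 0 < R \<Longrightarrow> 0 < d \<Longrightarrow> \<exists>K. \<forall>x\<ge>K. \<forall>u. \<bar>u\<bar> \<le> R \<longrightarrow>
      (1 - d) * \<nu> x \<le> \<nu> (x + u) \<and> \<nu> (x + u) \<le> (1 + d) * \<nu> x"
    and comparable: "\<exists>C\<ge>1. \<forall>x y. 4 < x \<longrightarrow> x / 4 \<le> y \<longrightarrow> \<nu> y \<le> C * \<nu> x"
begin

section \<open>Estimates for one window A and one grid of mesh h\<close>

context
  fixes C d z K a :: real and A :: "real set" and h :: real and n :: nat and \<alpha> :: real
  assumes C: "1 \<le> C" "\<And>x y. 4 < x \<Longrightarrow> x / 4 \<le> y \<Longrightarrow> \<nu> y \<le> C * \<nu> x"
    and d: "0 < d" "d < 1"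
    and z: "0 < z" "\<And>t. 0 \<le> t \<Longrightarrow> t \<le> t0 \<Longrightarrow> emeasure (P t) {x. z < \<bar>x\<bar>} \<le> ennreal d"
    and K_lower: "\<And>t \<phi>. 0 < t \<Longrightarrow> t \<le> t0 \<Longrightarrow> \<phi> \<in> borel_measurable borel \<Longrightarrow> (\<And>x. x \<le> K \<Longrightarrow> \<phi> x = 0) \<Longrightarrow>
      ennreal ((1 - d) * t) * (\<integral>\<^sup>+ x. \<phi> x * ennreal (\<nu> x) \<partial>lborel) \<le> (\<integral>\<^sup>+ x. \<phi> x \<partial>P t)"
    and K_upper: "\<And>t \<phi>. 0 < t \<Longrightarrow> t \<le> t0 \<Longrightarrow> \<phi> \<in> borel_measurable borel \<Longrightarrow> (\<And>x. x \<le> K \<Longrightarrow> \<phi> x = 0) \<Longrightarrow>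
      (\<integral>\<^sup>+ x. \<phi> x \<partial>P t) \<le> ennreal ((1 + d) * t) * (\<integral>\<^sup>+ x. \<phi> x * ennreal (\<nu> x) \<partial>lborel)"
    and shift: "\<And>x u. a \<le> x \<Longrightarrow> \<bar>u\<bar> \<le> 2 * z \<Longrightarrow>
      (1 - d) * \<nu> x \<le> \<nu> (x + u) \<and> \<nu> (x + u) \<le> (1 + d) * \<nu> x"
    \<comment> \<open>For the jump threshold \<open>a / 2\<close>: a jump over it from a state at
      most z exceeds K, and \<open>x / 4 \<le> a / 2 - z\<close> for every x in
      \<open>{a..a + 2}\<close>, so \<nu> at the jump size is at most C times \<nu> x.\<close>
    and a: "8 < a" "K < a / 2 - z" "z + 1 \<le> a / 4"
    and A [measurable]: "A \<in> sets borel" and A_sub: "A \<subseteq> {a..a + 2}"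
    and h: "0 < h" "real n * h \<le> t0"
    and \<alpha>: "0 \<le> \<alpha>" "(\<integral>\<^sup>+ x. indicator A x * ennreal (\<nu> x) \<partial>lborel) = ennreal \<alpha>"
begin

lemma prob_Ph [simp]: "prob_space (P h)"
  using h by (intro prob_P) auto

lemma time_le: "k \<le> n \<Longrightarrow> real k * h \<le> real n * h"
  using h by (intro mult_right_mono) auto

lemma time_le_t0: "k \<le> n \<Longrightarrow> real k * h \<le> t0"
  using time_le[of k] h by linarith

text \<open>From below \<open>a / 2\<close> the walk still has to cover more than half of x to reach
  a point x of A, and \<nu> at that distance is at most \<open>C * \<nu> x\<close>. The factor 2
  bounds \<open>1 + d\<close>. Zero steps are separate because the tail bound is for positive
  times.\<close>

lemma walk_small:
  assumes "k \<le> n" "y < a / 2"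
  shows "chain (+) (P h) k (indicator A) y \<le> ennreal (2 * C * (real n * h) * \<alpha>)"
proof (cases "k = 0")
  case True
  have "y \<notin> A" using A_sub assms a by auto
  then show ?thesis using True by simp
next
  case False
  have vanish: "indicator A (y + s) = (0 :: ennreal)" if "s \<le> K" for s
    using A_sub that assms a z by (auto simp: indicator_def)
  have "chain (+) (P h) k (indicator A) y = (\<integral>\<^sup>+ s. indicator A (y + s) \<partial>P (real k * h))"
    by (intro walk_eq h) auto
  also have "\<dots> \<le> ennreal ((1 + d) * (real k * h)) * (\<integral>\<^sup>+ s. indicator A (y + s) * ennreal (\<nu> s) \<partial>lborel)"
    using False h time_le_t0 assms by (intro K_upper vanish) auto
  also have "(\<integral>\<^sup>+ s. indicator A (y + s) * ennreal (\<nu> s) \<partial>lborel)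
      = (\<integral>\<^sup>+ x. indicator A x * ennreal (\<nu> (x - y)) \<partial>lborel)"
    by (subst nn_integral_real_affine[where c = 1 and t = "-y"]) auto
  also have "\<dots> \<le> (\<integral>\<^sup>+ x. ennreal C * (indicator A x * ennreal (\<nu> x)) \<partial>lborel)"
  proof (rule nn_integral_mono)
    fix x
    show "indicator A x * ennreal (\<nu> (x - y)) \<le> ennreal C * (indicator A x * ennreal (\<nu> x))"
    proof (cases "x \<in> A")
      case True
      then have "a \<le> x" using A_sub by auto
      then have "\<nu> (x - y) \<le> C * \<nu> x" using a assms by (intro C) auto
      then show ?thesis using True C \<nu>_nonneg by (simp flip: ennreal_mult)
    qed simp
  qed
  also have "\<dots> = ennreal (C * \<alpha>)"
    using C \<alpha> by (simp add: nn_integral_cmult ennreal_mult)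
  also have "ennreal ((1 + d) * (real k * h)) * ennreal (C * \<alpha>) \<le> ennreal (2 * C * (real n * h) * \<alpha>)"
  proof -
    have "(1 + d) * (real k * h) * (C * \<alpha>) \<le> 2 * (real n * h) * (C * \<alpha>)"
      using d h C \<alpha> time_le[OF assms(1)] by (intro mult_right_mono mult_mono) auto
    then show ?thesis using d h C \<alpha> by (simp flip: ennreal_mult add: mult_ac ennreal_leI)
  qed
  finally show ?thesis by (auto simp: mult_left_mono)
qed

definition jump_hits :: "nat \<Rightarrow> real \<Rightarrow> ennreal" where
  "jump_hits k y = (\<integral>\<^sup>+ \<xi>. indicator {a / 2..} (y + \<xi>) * chain (+) (P h) k (indicator A) (y + \<xi>) \<partial>P h)"

text \<open>With the later displacement s held fixed, the end point \<open>x = y + \<xi> + s\<close>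
  replaces the jump \<xi> as variable of integration. It ranges over A, so that the \<nu>-mass of A
  can be split off.\<close>

lemma swap_jump:
  assumes "k \<le> n"
  shows "(\<integral>\<^sup>+ \<xi>. (indicator {a / 2..} (y + \<xi>) * chain (+) (P h) k (indicator A) (y + \<xi>)) * ennreal (\<nu> \<xi>) \<partial>lborel)
    = (\<integral>\<^sup>+ s. \<integral>\<^sup>+ x. indicator {a / 2..} (x - s) * indicator A x * ennreal (\<nu> (x - (y + s))) \<partial>lborel \<partial>P (real k * h))"
proof -
  interpret prob_space "P (real k * h)" using h by (intro prob_P) auto
  interpret pair_sigma_finite "P (real k * h)" lborel ..
  have "(\<integral>\<^sup>+ \<xi>. (indicator {a / 2..} (y + \<xi>) * chain (+) (P h) k (indicator A) (y + \<xi>)) * ennreal (\<nu> \<xi>) \<partial>lborel)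
    = (\<integral>\<^sup>+ \<xi>. \<integral>\<^sup>+ s. indicator {a / 2..} (y + \<xi>) * indicator A (y + \<xi> + s) * ennreal (\<nu> \<xi>) \<partial>P (real k * h) \<partial>lborel)"
    using h by (simp add: walk_eq nn_integral_cmult nn_integral_multc)
  also have "\<dots> = (\<integral>\<^sup>+ s. \<integral>\<^sup>+ \<xi>. indicator {a / 2..} (y + \<xi>) * indicator A (y + \<xi> + s) * ennreal (\<nu> \<xi>) \<partial>lborel \<partial>P (real k * h))"
    by (rule Fubini') measurable
  also have "\<dots> = (\<integral>\<^sup>+ s. \<integral>\<^sup>+ x. indicator {a / 2..} (x - s) * indicator A x * ennreal (\<nu> (x - (y + s))) \<partial>lborel \<partial>P (real k * h))"
  proof (rule nn_integral_cong)
    fix s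
    show "(\<integral>\<^sup>+ \<xi>. indicator {a / 2..} (y + \<xi>) * indicator A (y + \<xi> + s) * ennreal (\<nu> \<xi>) \<partial>lborel)
      = (\<integral>\<^sup>+ x. indicator {a / 2..} (x - s) * indicator A x * ennreal (\<nu> (x - (y + s))) \<partial>lborel)"
      by (subst nn_integral_real_affine[where c = 1 and t = "-(y + s)"]) (auto simp: algebra_simps)
  qed
  finally show ?thesis .
qed

lemma jump_vanish:
  assumes "y \<le> z" "\<xi> \<le> K"
  shows "indicator {a / 2..} (y + \<xi>) = (0 :: ennreal)"
  using assms a by (auto simp: indicator_def)

text \<open>One factor \<open>1 + d\<close> replaces the law of the jump by
  \<open>h * \<nu>\<close>. In the other factor, \<open>1 + d\<close> belongs to displacements with
  \<open>\<bar>s\<bar> \<le> z\<close>, where \<nu> is shifted by at most 2 z, and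
  \<open>C * d\<close> to larger ones, where only comparability is left but the probability is at
  most d.\<close>

lemma jump_hits_upper:
  assumes "k \<le> n" "1 \<le> n" "0 \<le> y" "y \<le> z"
  shows "jump_hits k y \<le> ennreal (h * ((1 + d) * (1 + d + C * d)) * \<alpha>)"
proof -
  have "h \<le> t0" using time_le_t0[of 1] assms by simp
  have inner: "(\<integral>\<^sup>+ x. indicator {a / 2..} (x - s) * indicator A x * ennreal (\<nu> (x - (y + s))) \<partial>lborel)
      \<le> ennreal ((1 + d) * \<alpha>) + ennreal (C * \<alpha>) * indicator {x. z < \<bar>x\<bar>} s" for s
  proof -
    define c where "c = (if \<bar>s\<bar> \<le> z then 1 + d else C)"
    have "0 \<le> c" using d C by (auto simp: c_def)
    have "(\<integral>\<^sup>+ x. indicator {a / 2..} (x - s) * indicator A x * ennreal (\<nu> (x - (y + s))) \<partial>lborel)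
      \<le> (\<integral>\<^sup>+ x. ennreal c * (indicator A x * ennreal (\<nu> x)) \<partial>lborel)"
    proof (rule nn_integral_mono)
      fix x
      show "indicator {a / 2..} (x - s) * indicator A x * ennreal (\<nu> (x - (y + s)))
        \<le> ennreal c * (indicator A x * ennreal (\<nu> x))"
      proof (cases "x \<in> A \<and> a / 2 \<le> x - s")
        case True
        then have x: "a \<le> x" "x \<le> a + 2" using A_sub by auto
        have "\<nu> (x - (y + s)) \<le> c * \<nu> x"
        proof (cases "\<bar>s\<bar> \<le> z")
          case True
          then have "\<bar>- (y + s)\<bar> \<le> 2 * z" using assms by linarith
          then show ?thesis using shift[of x "- (y + s)"] x True by (simp add: c_def algebra_simps)
        next
          case False
          have "\<nu> (x - (y + s)) \<le> C * \<nu> x"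
            by (rule C(2); use True x a assms in \<open>simp add: field_simps\<close>)
          then show ?thesis using False by (simp add: c_def)
        qed
        then show ?thesis using True \<open>0 \<le> c\<close> \<nu>_nonneg by (simp flip: ennreal_mult)
      qed (auto simp: indicator_def)
    qed
    also have "\<dots> = ennreal (c * \<alpha>)"
      using \<open>0 \<le> c\<close> \<alpha> by (simp add: nn_integral_cmult ennreal_mult)
    also have "\<dots> \<le> ennreal ((1 + d) * \<alpha>) + ennreal (C * \<alpha>) * indicator {x. z < \<bar>x\<bar>} s"
      by (auto simp: c_def indicator_def)
    finally show ?thesis .
  qed
  have "jump_hits k y \<le> ennreal ((1 + d) * h) *
    (\<integral>\<^sup>+ \<xi>. (indicator {a / 2..} (y + \<xi>) * chain (+) (P h) k (indicator A) (y + \<xi>)) * ennreal (\<nu> \<xi>) \<partial>lborel)"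
    unfolding jump_hits_def using h \<open>h \<le> t0\<close> assms
    by (intro K_upper) (auto simp: jump_vanish)
  also have "\<dots> \<le> ennreal ((1 + d) * h) *
    (\<integral>\<^sup>+ s. ennreal ((1 + d) * \<alpha>) + ennreal (C * \<alpha>) * indicator {x. z < \<bar>x\<bar>} s \<partial>P (real k * h))"
    unfolding swap_jump[OF assms(1)] by (intro mult_left_mono nn_integral_mono inner) auto
  also have "\<dots> = ennreal ((1 + d) * h) *
    (ennreal ((1 + d) * \<alpha>) + ennreal (C * \<alpha>) * emeasure (P (real k * h)) {x. z < \<bar>x\<bar>})"
    using prob_space.emeasure_space_1[OF prob_P[of "real k * h"]] h
    by (simp add: nn_integral_add nn_integral_cmult)
  also have "\<dots> \<le> ennreal ((1 + d) * h) * (ennreal ((1 + d) * \<alpha>) + ennreal (C * \<alpha>) * ennreal d)"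
    using h time_le_t0[OF assms(1)] by (intro mult_left_mono add_left_mono z) auto
  also have "\<dots> = ennreal ((1 + d) * h * ((1 + d) * \<alpha> + C * \<alpha> * d))"
    using h d C \<alpha> by (simp flip: ennreal_mult ennreal_plus)
  also have "(1 + d) * h * ((1 + d) * \<alpha> + C * \<alpha> * d) = h * ((1 + d) * (1 + d + C * d)) * \<alpha>"
    by (simp add: algebra_simps)
  finally show ?thesis .
qed

text \<open>Only displacements with \<open>\<bar>s\<bar> \<le> z\<close> are kept. The three factors
  \<open>1 - d\<close> come from the law of the jump, the shift of \<nu> and the probability of such
  a displacement.\<close>

lemma jump_hits_lower:
  assumes "k \<le> n" "1 \<le> n" "0 \<le> y" "y \<le> z"
  shows "ennreal (h * (1 - d) ^ 3 * \<alpha>) \<le> jump_hits k y"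
proof -
  have "h \<le> t0" using time_le_t0[of 1] assms by simp
  interpret Pk: prob_space "P (real k * h)" using h by (intro prob_P) auto
  have inner: "ennreal ((1 - d) * \<alpha>) * indicator {x. \<bar>x\<bar> \<le> z} s \<le>
      (\<integral>\<^sup>+ x. indicator {a / 2..} (x - s) * indicator A x * ennreal (\<nu> (x - (y + s))) \<partial>lborel)" for s
  proof (cases "\<bar>s\<bar> \<le> z")
    case s: True
    have "ennreal ((1 - d) * \<alpha>) = (\<integral>\<^sup>+ x. ennreal (1 - d) * (indicator A x * ennreal (\<nu> x)) \<partial>lborel)"
      using d \<alpha> by (simp add: nn_integral_cmult ennreal_mult)
    also have "\<dots> \<le> (\<integral>\<^sup>+ x. indicator {a / 2..} (x - s) * indicator A x * ennreal (\<nu> (x - (y + s))) \<partial>lborel)"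
    proof (rule nn_integral_mono)
      fix x
      show "ennreal (1 - d) * (indicator A x * ennreal (\<nu> x))
        \<le> indicator {a / 2..} (x - s) * indicator A x * ennreal (\<nu> (x - (y + s)))"
      proof (cases "x \<in> A")
        case True
        then have x: "a \<le> x" using A_sub by auto
        have "\<bar>- (y + s)\<bar> \<le> 2 * z" using s assms by linarith
        then have "(1 - d) * \<nu> x \<le> \<nu> (x - (y + s))" "a / 2 \<le> x - s"
          using shift[of x "- (y + s)"] s x a by (auto simp: algebra_simps)
        then show ?thesis using True d \<nu>_nonneg by (simp flip: ennreal_mult)
      qed simp
    qed
    finally show ?thesis using s by simp
  qed simp
  have compl: "{x. \<bar>x\<bar> \<le> z} = space (P (real k * h)) - {x. z < \<bar>x\<bar>}"
    using sets_eq_imp_space_eq[OF sets_P[of "real k * h"]] by auto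
  have Z: "{x. z < \<bar>x\<bar>} \<in> sets (P (real k * h))"
    by simp
  have "Pk.prob {x. z < \<bar>x\<bar>} \<le> d"
    using z(2)[of "real k * h"] h time_le_t0[OF assms(1)] d
    by (simp add: Pk.emeasure_eq_measure)
  then have "ennreal (1 - d) \<le> emeasure (P (real k * h)) {x. \<bar>x\<bar> \<le> z}"
    unfolding compl Pk.emeasure_eq_measure Pk.prob_compl[OF Z] by (intro ennreal_leI) simp
  then have "ennreal ((1 - d) * h) * (ennreal ((1 - d) * \<alpha>) * ennreal (1 - d))
      \<le> ennreal ((1 - d) * h) * (ennreal ((1 - d) * \<alpha>) * emeasure (P (real k * h)) {x. \<bar>x\<bar> \<le> z})"
    by (intro mult_left_mono) auto
  also have "\<dots> = ennreal ((1 - d) * h) *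
      (\<integral>\<^sup>+ s. ennreal ((1 - d) * \<alpha>) * indicator {x. \<bar>x\<bar> \<le> z} s \<partial>P (real k * h))"
    by (simp add: nn_integral_cmult)
  also have "\<dots> \<le> ennreal ((1 - d) * h) *
    (\<integral>\<^sup>+ \<xi>. (indicator {a / 2..} (y + \<xi>) * chain (+) (P h) k (indicator A) (y + \<xi>)) * ennreal (\<nu> \<xi>) \<partial>lborel)"
    unfolding swap_jump[OF assms(1)] by (intro mult_left_mono nn_integral_mono inner) auto
  also have "\<dots> \<le> jump_hits k y"
    unfolding jump_hits_def using h \<open>h \<le> t0\<close> assms
    by (intro K_lower) (auto simp: jump_vanish)
  finally show ?thesis
    using h d \<alpha> by (simp flip: ennreal_mult add: power3_eq_cube mult_ac)
qed

text \<open>\<open>crossing_le_lindley_tail\<close> with p = 1/2: a displacement of modulus at most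
  \<open>z / 2\<close> keeps the walk above \<open>z / 2\<close> once it is above z. Hence the two
  halves, of z and of d, in the hypotheses.\<close>

lemma crossing_prob_le:
  assumes "\<And>m. m \<le> n \<Longrightarrow> chain lindley (P h) m (indicator {z / 2<..}) 0 \<le> ennreal (d / 2)"
    and half: "\<And>t. 0 \<le> t \<Longrightarrow> t \<le> t0 \<Longrightarrow> emeasure (P t) {x. z / 2 < \<bar>x\<bar>} \<le> ennreal (1 / 2)"
    and "m \<le> n"
  shows "chain (absorbed_lindley z) (P h) m (indicator {z<..}) 0 \<le> ennreal d"
proof -
  have "ennreal (1 / 2) \<le> chain (+) (P h) k (indicator {z / 2<..}) y" if "k \<le> m" "z < y" for k y
  proof -
    interpret Pk: prob_space "P (real k * h)" using h by (intro prob_P) auto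
    have Z: "{x. z / 2 < \<bar>x\<bar>} \<in> sets (P (real k * h))"
      by simp
    have "ennreal (Pk.prob {x. z / 2 < \<bar>x\<bar>}) \<le> ennreal (1 / 2)"
      unfolding Pk.emeasure_eq_measure[symmetric]
      using h time_le_t0[of k] that \<open>m \<le> n\<close> by (intro half) auto
    then have "Pk.prob {x. z / 2 < \<bar>x\<bar>} \<le> 1 / 2"
      by (subst (asm) ennreal_le_iff) auto
    then have "ennreal (1 / 2) \<le> emeasure (P (real k * h)) (space (P (real k * h)) - {x. z / 2 < \<bar>x\<bar>})"
      unfolding Pk.emeasure_eq_measure Pk.prob_compl[OF Z] by (intro ennreal_leI) simp
    also have "\<dots> = (\<integral>\<^sup>+ s. indicator (space (P (real k * h)) - {x. z / 2 < \<bar>x\<bar>}) s \<partial>P (real k * h))"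
      by (rule nn_integral_indicator[OF sets.compl_sets[OF Z], symmetric])
    also have "\<dots> \<le> (\<integral>\<^sup>+ s. indicator {z / 2<..} (y + s) \<partial>P (real k * h))"
      using that by (intro nn_integral_mono) (auto simp: indicator_def)
    also have "\<dots> = chain (+) (P h) k (indicator {z / 2<..}) y"
      by (intro walk_eq[symmetric] h) auto
    finally show ?thesis .
  qed
  then have "ennreal (1 / 2) * chain (absorbed_lindley z) (P h) m (indicator {z<..}) 0
      \<le> chain lindley (P h) m (indicator {z / 2<..}) 0"
    by (intro crossing_le_lindley_tail) auto
  also have "\<dots> \<le> ennreal (d / 2)"
    using assms by auto
  finally have "ennreal 2 * (ennreal (1 / 2) * chain (absorbed_lindley z) (P h) m (indicator {z<..}) 0)
      \<le> ennreal 2 * ennreal (d / 2)"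
    by (rule mult_left_mono) auto
  moreover have "ennreal 2 * (ennreal (1 / 2) * x) = x" for x
    by (subst mult.assoc[symmetric], subst ennreal_mult[symmetric]) auto
  moreover have "ennreal 2 * ennreal (d / 2) = ennreal d"
    using d by (subst ennreal_mult[symmetric]) auto
  ultimately show ?thesis by metis
qed

text \<open>The self-bounding step. \<open>lindley_upper\<close> bounds every hitting probability by
  an expression containing their maximum c, multiplied by d < 1; the hypothesis on r is what solving
  for c leaves.\<close>

lemma lindley_grid_upper:
  assumes crossing: "\<And>m. m \<le> n \<Longrightarrow> chain (absorbed_lindley z) (P h) m (indicator {z<..}) 0 \<le> ennreal d"
    and "1 \<le> n"
    and r: "2 * C * d + (1 + d) * (1 + d + C * d) \<le> r * (1 - d)"
  shows "chain lindley (P h) n (indicator A) 0 \<le> ennreal (r * (real n * h) * \<alpha>)"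
proof -
  define v where "v k = chain lindley (P h) k (indicator A) 0" for k
  \<comment> \<open>The maximum over all k, since a return to 0 may leave any smaller number of
    steps.\<close>
  define c where "c = Max (v ` {..n})"
  define E where "E = h * ((1 + d) * (1 + d + C * d)) * \<alpha>"
  define D where "D = 2 * C * (real n * h) * \<alpha>"
  have "0 \<le> E" "0 \<le> D" using h d C \<alpha> by (auto simp: E_def D_def)
  have v_le: "v k \<le> c" if "k \<le> n" for k using that by (auto simp: c_def)
  have "c \<in> v ` {..n}" unfolding c_def by (intro Max_in) auto
  moreover have "v k \<le> 1" for k
    unfolding v_def by (rule chain_le_1) (auto simp: indicator_def)
  ultimately have "c \<le> 1" by auto
  \<comment> \<open>Finiteness of c is what allows the term \<open>c' * d\<close> to be moved to the
    other side.\<close>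
  then obtain c' where c': "c = ennreal c'" "0 \<le> c'"
    by (cases c) (auto simp: top_unique)
  have "v m \<le> ennreal ((D + c') * d + real n * E)" if "m \<le> n" for m
  proof -
    have "v m \<le> (ennreal D + c) * chain (absorbed_lindley z) (P h) m (indicator {z<..}) 0 + of_nat m * ennreal E"
      unfolding v_def
    proof (rule lindley_upper[where b = "a / 2"])
      show "chain (+) (P h) k (indicator A) y \<le> ennreal D" if "k < m" "z < y" "y < a / 2" for k y
        using that \<open>m \<le> n\<close> walk_small[of k y] by (simp add: D_def)
      show "chain lindley (P h) k (indicator A) 0 \<le> c" if "k < m" for k
        using that \<open>m \<le> n\<close> v_le[of k] by (simp add: v_def)
      show "(\<integral>\<^sup>+ \<xi>. indicator {a / 2..} (y + \<xi>) * chain (+) (P h) k (indicator A) (y + \<xi>) \<partial>P h) \<le> ennreal E"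
        if "k < m" "0 \<le> y" "y \<le> z" for k y
        using jump_hits_upper[of k y] that \<open>m \<le> n\<close> assms by (simp add: jump_hits_def E_def)
      show "indicator A y = (0 :: ennreal)" if "0 \<le> y" "y \<le> z" for y
        using that A_sub a by (auto simp: indicator_def)
    qed (use a z in auto)
    also have "\<dots> \<le> (ennreal D + c) * ennreal d + of_nat n * ennreal E"
      using that by (intro add_mono mult_mono crossing) auto
    also have "\<dots> = ennreal ((D + c') * d + real n * E)"
      using \<open>0 \<le> E\<close> \<open>0 \<le> D\<close> c' d
      by (simp add: ennreal_of_nat_eq_real_of_nat flip: ennreal_mult ennreal_plus)
    finally show ?thesis .
  qed
  with \<open>c \<in> v ` {..n}\<close> have "c \<le> ennreal ((D + c') * d + real n * E)" by auto
  then have "c' \<le> (D + c') * d + real n * E"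
    using c' \<open>0 \<le> E\<close> \<open>0 \<le> D\<close> d by (simp only: c'(1)) (subst (asm) ennreal_le_iff, auto)
  then have "c' * (1 - d) \<le> D * d + real n * E" by (simp add: algebra_simps)
  also have "\<dots> = (2 * C * d + (1 + d) * (1 + d + C * d)) * (real n * h * \<alpha>)"
    by (simp add: D_def E_def algebra_simps)
  also have "\<dots> \<le> (r * (1 - d)) * (real n * h * \<alpha>)"
    using r h \<alpha> by (intro mult_right_mono) auto
  finally have "c' \<le> r * (real n * h) * \<alpha>"
    using d by (simp add: mult_ac)
  then show ?thesis
    using v_le[of n] c' by (auto simp: v_def intro: order.trans ennreal_leI)
qed

text \<open>\<open>lindley_lower\<close> asks for the chain after the jump,
  \<open>jump_hits_lower\<close> provides the walk. The replacement costs D, but only on the event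
  of a jump over \<open>a / 2\<close>, of probability at most \<open>2 * h * \<tau>\<close>; the
  loss is a product of two small quantities and fits into \<open>d * h * \<alpha>\<close>.\<close>

lemma lindley_grid_lower:
  assumes crossing: "chain (absorbed_lindley z) (P h) n (indicator {z<..}) 0 \<le> ennreal d"
    and "1 \<le> n"
    and \<tau>: "0 \<le> \<tau>" "(\<integral>\<^sup>+ x. indicator {a / 2 - z..} x * ennreal (\<nu> x) \<partial>lborel) \<le> ennreal \<tau>"
      "4 * C * t0 * \<tau> \<le> d"
    and r: "0 \<le> r" "r \<le> (1 - d) * ((1 - d) ^ 3 - d)"
  shows "ennreal (r * (real n * h) * \<alpha>) \<le> chain lindley (P h) n (indicator A) 0"
proof -
  have "h \<le> t0" using time_le_t0[of 1] assms by simp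
  define D where "D = 2 * C * (real n * h) * \<alpha>"
  define E where "E = h * ((1 - d) ^ 3 - d) * \<alpha>"
  have "0 \<le> D" using h C \<alpha> by (auto simp: D_def)
  have "0 \<le> (1 - d) * ((1 - d) ^ 3 - d)" using r by linarith
  then have "0 \<le> (1 - d) ^ 3 - d" using d by (simp add: zero_le_mult_iff)
  then have "0 \<le> E" using h \<alpha> by (simp add: E_def)
  have jump: "emeasure (P h) {\<xi>. a / 2 \<le> y + \<xi>} \<le> ennreal (2 * h * \<tau>)" if "y \<le> z" for y
  proof -
    have "emeasure (P h) {\<xi>. a / 2 \<le> y + \<xi>} = (\<integral>\<^sup>+ \<xi>. indicator {\<xi>. a / 2 \<le> y + \<xi>} \<xi> \<partial>P h)"
      by (subst nn_integral_indicator) auto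
    also have "\<dots> \<le> ennreal ((1 + d) * h) *
        (\<integral>\<^sup>+ \<xi>. indicator {\<xi>. a / 2 \<le> y + \<xi>} \<xi> * ennreal (\<nu> \<xi>) \<partial>lborel)"
      using that h \<open>h \<le> t0\<close> a by (intro K_upper) (auto simp: indicator_def)
    also have "\<dots> \<le> ennreal (2 * h) * (\<integral>\<^sup>+ x. indicator {a / 2 - z..} x * ennreal (\<nu> x) \<partial>lborel)"
      using that d h by (intro mult_mono nn_integral_mono) (auto simp: indicator_def ennreal_leI)
    also have "\<dots> \<le> ennreal (2 * h) * ennreal \<tau>"
      by (intro mult_left_mono \<tau>) auto
    finally show ?thesis using \<tau> h by (simp flip: ennreal_mult)
  qed
  have "ennreal E \<le> (\<integral>\<^sup>+ \<xi>. indicator {a / 2..} (y + \<xi>) * chain lindley (P h) k (indicator A) (y + \<xi>) \<partial>P h)"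
    (is "_ \<le> ?J") if "k < n" "0 \<le> y" "y \<le> z" for k y
  proof -
    have "ennreal E + ennreal (d * h * \<alpha>) = ennreal (h * (1 - d) ^ 3 * \<alpha>)"
      using \<open>0 \<le> E\<close> d h \<alpha> by (simp add: E_def algebra_simps flip: ennreal_plus)
    also have "\<dots> \<le> jump_hits k y"
      using that assms by (intro jump_hits_lower) auto
    also have "\<dots> \<le> (\<integral>\<^sup>+ \<xi>. indicator {a / 2..} (y + \<xi>) * chain lindley (P h) k (indicator A) (y + \<xi>) +
        ennreal D * indicator {\<xi>. a / 2 \<le> y + \<xi>} \<xi> \<partial>P h)"
      unfolding jump_hits_def
    proof (rule nn_integral_mono)
      fix \<xi>
      show "indicator {a / 2..} (y + \<xi>) * chain (+) (P h) k (indicator A) (y + \<xi>)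
        \<le> indicator {a / 2..} (y + \<xi>) * chain lindley (P h) k (indicator A) (y + \<xi>) +
          ennreal D * indicator {\<xi>. a / 2 \<le> y + \<xi>} \<xi>"
      proof (cases "a / 2 \<le> y + \<xi>")
        case True
        have "chain (+) (P h) k (indicator A) (y + \<xi>) \<le> chain lindley (P h) k (indicator A) (y + \<xi>) + ennreal D"
          unfolding D_def using True a that by (intro walk_le_lindley walk_small) auto
        then show ?thesis using True by simp
      qed simp
    qed
    also have "\<dots> = ?J + ennreal D * emeasure (P h) {\<xi>. a / 2 \<le> y + \<xi>}"
      by (simp add: nn_integral_add nn_integral_cmult)
    also have "\<dots> \<le> ?J + ennreal D * ennreal (2 * h * \<tau>)"
      using that by (intro add_left_mono mult_left_mono jump) auto
    also have "ennreal D * ennreal (2 * h * \<tau>) = ennreal ((4 * C * (real n * h) * \<tau>) * (h * \<alpha>))"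
      using \<open>0 \<le> D\<close> h \<tau> by (simp add: D_def mult_ac flip: ennreal_mult)
    also have "\<dots> \<le> ennreal (d * (h * \<alpha>))"
    proof (intro ennreal_leI mult_right_mono)
      have "4 * C * (real n * h) * \<tau> \<le> 4 * C * t0 * \<tau>"
        using h C \<tau> by (intro mult_right_mono mult_left_mono) auto
      then show "4 * C * (real n * h) * \<tau> \<le> d" using \<tau> by linarith
    qed (use h \<alpha> in auto)
    finally have "ennreal E + ennreal (d * h * \<alpha>) \<le> ?J + ennreal (d * h * \<alpha>)"
      by (auto simp: mult.assoc add_left_mono)
    then show ?thesis
      by (simp add: add.commute[of _ "ennreal (d * h * \<alpha>)"] ennreal_add_left_cancel_le)
  qed
  then have "of_nat n * ennreal E * chain (absorbed_lindley z) (P h) n (indicator {..z}) 0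
      \<le> chain lindley (P h) n (indicator A) 0"
    using a z by (intro lindley_lower[where b = "a / 2"]) auto
  moreover have "ennreal (1 - d) \<le> chain (absorbed_lindley z) (P h) n (indicator {..z}) 0" (is "_ \<le> ?\<sigma>")
  proof -
    have "ennreal (1 - d) + ennreal d = ?\<sigma> + chain (absorbed_lindley z) (P h) n (indicator {z<..}) 0"
      using d by (simp add: survival_add_crossing flip: ennreal_plus)
    also have "\<dots> \<le> ?\<sigma> + ennreal d" by (intro add_left_mono crossing)
    finally show ?thesis
      by (simp add: add.commute[of _ "ennreal d"] ennreal_add_left_cancel_le)
  qed
  ultimately have "of_nat n * ennreal E * ennreal (1 - d) \<le> chain lindley (P h) n (indicator A) 0"
    by (meson mult_left_mono order.trans zero_le)
  moreover have "ennreal (r * (real n * h) * \<alpha>) \<le> of_nat n * ennreal E * ennreal (1 - d)"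
  proof -
    have "r * (real n * h * \<alpha>) \<le> ((1 - d) * ((1 - d) ^ 3 - d)) * (real n * h * \<alpha>)"
      using r h \<alpha> by (intro mult_right_mono) auto
    also have "\<dots> = real n * E * (1 - d)" by (simp add: E_def)
    finally show ?thesis
      using \<open>0 \<le> E\<close> d
      by (simp add: ennreal_of_nat_eq_real_of_nat ennreal_leI mult.assoc flip: ennreal_mult)
  qed
  ultimately show ?thesis by (rule order.trans[rotated])
qed

end

section \<open>Tail mass of the jump density and choice of the constants\<close>

lemma tail_finite: "\<exists>K. (\<integral>\<^sup>+ x. indicator {K..} x * ennreal (\<nu> x) \<partial>lborel) < \<infinity>"
proof -
  obtain K where K: "\<forall>t\<in>{0<..t0}. \<forall>\<phi>\<in>borel_measurable borel. (\<forall>x\<le>K. \<phi> x = 0) \<longrightarrow>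
      ennreal ((1 - 1 / 2) * t) * (\<integral>\<^sup>+ x. \<phi> x * ennreal (\<nu> x) \<partial>lborel) \<le> (\<integral>\<^sup>+ x. \<phi> x \<partial>P t) \<and>
      (\<integral>\<^sup>+ x. \<phi> x \<partial>P t) \<le> ennreal ((1 + 1 / 2) * t) * (\<integral>\<^sup>+ x. \<phi> x * ennreal (\<nu> x) \<partial>lborel)"
    using tail[OF half_gt_zero[OF zero_less_one]] ..
  interpret prob_space "P t0" using t0 by (intro prob_P) auto
  \<comment> \<open>A probability measure dominates \<open>t0 / 2\<close> times \<nu> beyond K; the
    start at \<open>K + 1\<close> makes the test function vanish at K itself.\<close>
  have "ennreal ((1 - 1 / 2) * t0) * (\<integral>\<^sup>+ x. indicator {K + 1..} x * ennreal (\<nu> x) \<partial>lborel)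
      \<le> (\<integral>\<^sup>+ x. indicator {K + 1..} x \<partial>P t0)"
    using t0 by (intro K[rule_format, THEN conjunct1]) auto
  also have "\<dots> \<le> 1" by (simp add: measure_le_1 emeasure_le_1)
  finally have "ennreal ((1 - 1 / 2) * t0) * (\<integral>\<^sup>+ x. indicator {K + 1..} x * ennreal (\<nu> x) \<partial>lborel) < \<infinity>"
    by (auto simp: less_top[symmetric] top_unique)
  then show ?thesis
    using t0 by (intro exI[of _ "K + 1"]) (auto simp: ennreal_mult_less_top)
qed

lemma tail_vanishes:
  assumes "0 < \<tau>"
  shows "\<exists>K. \<forall>k\<ge>K. (\<integral>\<^sup>+ x. indicator {k..} x * ennreal (\<nu> x) \<partial>lborel) \<le> ennreal \<tau>"
proof -
  obtain K where K: "(\<integral>\<^sup>+ x. indicator {K..} x * ennreal (\<nu> x) \<partial>lborel) < \<infinity>"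
    using tail_finite by auto
  let ?f = "\<lambda>i x. indicator {K + real i..} x * ennreal (\<nu> x)"
  have "(\<lambda>i. \<integral>\<^sup>+ x. ?f i x \<partial>lborel) \<longlonglongrightarrow> (\<integral>\<^sup>+ (x :: real). 0 \<partial>lborel)"
  proof (rule nn_integral_dominated_convergence[where w = "\<lambda>x. indicator {K..} x * ennreal (\<nu> x)"])
    show "AE x in lborel. (\<lambda>i. ?f i x) \<longlonglongrightarrow> 0"
    proof (rule AE_I2)
      fix x :: real
      obtain N :: nat where N: "x - K < real N" using reals_Archimedean2 by auto
      have "eventually (\<lambda>i. ?f i x = 0) sequentially"
        using eventually_ge_at_top[of N]
      proof eventually_elim
        case (elim i)
        then have "real N \<le> real i" by simp
        with N show ?case by (auto simp: indicator_def)
      qed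
      then show "(\<lambda>i. ?f i x) \<longlonglongrightarrow> 0" by (rule tendsto_eventually)
    qed
  qed (use K in \<open>auto simp: indicator_def\<close>)
  then have "eventually (\<lambda>i. (\<integral>\<^sup>+ x. ?f i x \<partial>lborel) < ennreal \<tau>) sequentially"
    using assms by (intro order_tendstoD) auto
  then obtain i where i: "(\<integral>\<^sup>+ x. ?f i x \<partial>lborel) < ennreal \<tau>"
    by (auto simp: eventually_sequentially)
  show ?thesis
  proof (intro exI[of _ "K + real i"] allI impI)
    fix k assume "K + real i \<le> k"
    then have "(\<integral>\<^sup>+ x. indicator {k..} x * ennreal (\<nu> x) \<partial>lborel) \<le> (\<integral>\<^sup>+ x. ?f i x \<partial>lborel)"
      by (intro nn_integral_mono) (auto simp: indicator_def)
    with i show "(\<integral>\<^sup>+ x. indicator {k..} x * ennreal (\<nu> x) \<partial>lborel) \<le> ennreal \<tau>" by simp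
  qed
qed

theorem lindley_grid_asymptotics:
  assumes \<epsilon>: "0 < \<epsilon>" "\<epsilon> \<le> 1"
  shows "\<exists>K>0. \<forall>a\<ge>K. (\<integral>\<^sup>+ x. indicator {a..} x * ennreal (\<nu> x) \<partial>lborel) < \<infinity> \<and>
    (\<forall>A h n. A \<in> sets borel \<longrightarrow> A \<subseteq> {a..a + 2} \<longrightarrow> 0 < h \<longrightarrow> 1 \<le> n \<longrightarrow> real n * h \<le> t0 \<longrightarrow>
      ennreal ((1 - \<epsilon>) * (real n * h)) * (\<integral>\<^sup>+ x. indicator A x * ennreal (\<nu> x) \<partial>lborel)
        \<le> chain lindley (P h) n (indicator A) 0 \<and>
      chain lindley (P h) n (indicator A) 0
        \<le> ennreal ((1 + \<epsilon>) * (real n * h)) * (\<integral>\<^sup>+ x. indicator A x * ennreal (\<nu> x) \<partial>lborel))"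
proof -
  obtain C where C: "1 \<le> C" "\<And>x y. 4 < x \<Longrightarrow> x / 4 \<le> y \<Longrightarrow> \<nu> y \<le> C * \<nu> x"
    using comparable by auto
  \<comment> \<open>Both \<open>d\<close> and \<open>C * d\<close> are then at most
    \<open>\<epsilon> / 20\<close>, and all losses together stay below \<epsilon>:
    \<open>1 - 20 * d\<close> on the lower side, the factor \<open>1 / (1 - d)\<close> of the
    self-bounding step included on the upper side.\<close>
  define d where "d = \<epsilon> / (20 * C)"
  have d: "0 < d" "C * d = \<epsilon> / 20" using C \<epsilon> by (auto simp: d_def)
  have "d \<le> C * d" using C d by simp
  then have d20: "d \<le> \<epsilon> / 20" "d < 1" using d \<epsilon> by auto
  obtain z1 where z1: "\<forall>t\<in>{0..t0}. emeasure (P t) {x. z1 < \<bar>x\<bar>} \<le> ennreal (d / 2)"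
    using tight[OF half_gt_zero[OF d(1)]] ..
  obtain z2 where z2: "\<forall>h m. 0 < h \<longrightarrow> real m * h \<le> t0 \<longrightarrow>
      chain lindley (P h) m (indicator {z2<..}) 0 \<le> ennreal (d / 2)"
    using lindley_tight[OF half_gt_zero[OF d(1)]] ..
  \<comment> \<open>Tightness is needed at \<open>z / 2\<close>, for the walk and for the chain, by
    the crossing bound.\<close>
  define z where "z = 2 * (\<bar>z1\<bar> + \<bar>z2\<bar> + 1)"
  have z: "0 < z" "z1 \<le> z / 2" "z2 \<le> z / 2" "z / 2 \<le> z" by (auto simp: z_def)
  have P_z: "emeasure (P t) {x. w < \<bar>x\<bar>} \<le> ennreal (d / 2)" if "0 \<le> t" "t \<le> t0" "z / 2 \<le> w" for t w
  proof -
    have "emeasure (P t) {x. w < \<bar>x\<bar>} \<le> emeasure (P t) {x. z1 < \<bar>x\<bar>}"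
      using that z by (intro emeasure_mono) auto
    then show ?thesis using z1 that by force
  qed
  have L_z: "chain lindley (P h) m (indicator {z / 2<..}) 0 \<le> ennreal (d / 2)"
    if "0 < h" "real m * h \<le> t0" for h m
  proof -
    have "chain lindley (P h) m (indicator {z / 2<..}) 0 \<le> chain lindley (P h) m (indicator {z2<..}) 0"
      using that z by (intro chain_mono) (auto simp: indicator_def intro: prob_P)
    then show ?thesis using z2 that by (meson order.trans)
  qed
  obtain K1 where K1: "\<forall>t\<in>{0<..t0}. \<forall>\<phi>\<in>borel_measurable borel. (\<forall>x\<le>K1. \<phi> x = 0) \<longrightarrow>
      ennreal ((1 - d) * t) * (\<integral>\<^sup>+ x. \<phi> x * ennreal (\<nu> x) \<partial>lborel) \<le> (\<integral>\<^sup>+ x. \<phi> x \<partial>P t) \<and>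
      (\<integral>\<^sup>+ x. \<phi> x \<partial>P t) \<le> ennreal ((1 + d) * t) * (\<integral>\<^sup>+ x. \<phi> x * ennreal (\<nu> x) \<partial>lborel)"
    using tail[OF d(1)] ..
  have "0 < 2 * z" using z by simp
  obtain K2 where K2: "\<forall>x\<ge>K2. \<forall>u. \<bar>u\<bar> \<le> 2 * z \<longrightarrow>
      (1 - d) * \<nu> x \<le> \<nu> (x + u) \<and> \<nu> (x + u) \<le> (1 + d) * \<nu> x"
    using long_tail[OF \<open>0 < 2 * z\<close> d(1)] ..
  \<comment> \<open>Since D is at most \<open>2 * C * t0 * \<alpha>\<close>, this keeps
    \<open>D * (2 * h * \<tau>)\<close> below \<open>d * h * \<alpha>\<close>.\<close>
  define \<tau> where "\<tau> = d / (4 * C * t0)"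
  have \<tau>: "0 < \<tau>" "4 * C * t0 * \<tau> \<le> d" using d C t0 by (auto simp: \<tau>_def)
  obtain K3 where K3: "\<And>k. K3 \<le> k \<Longrightarrow> (\<integral>\<^sup>+ x. indicator {k..} x * ennreal (\<nu> x) \<partial>lborel) \<le> ennreal \<tau>"
    using tail_vanishes[OF \<tau>(1)] by auto
  obtain k where k: "0 \<le> k" "K1 \<le> k" "K2 \<le> k" "K3 \<le> k"
    by (rule that[of "Max {0, K1, K2, K3}"]) auto
  \<comment> \<open>Chosen so that \<open>K / 2 - z\<close> exceeds k and \<open>K / 4\<close>
    exceeds \<open>z + 1\<close>.\<close>
  define K where "K = 4 * (k + z) + 9"
  have bigK: "0 < K" "K2 \<le> K" "8 < K" "K1 < K / 2 - z" "K3 < K / 2 - z" "K3 \<le> K" "z + 1 \<le> K / 4"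
    using z(1) k by (auto simp: K_def field_simps)
  show ?thesis
  proof (intro exI[of _ K] conjI allI impI)
    show "0 < K" by fact
    fix a assume a: "K \<le> a"
    show tail_a: "(\<integral>\<^sup>+ x. indicator {a..} x * ennreal (\<nu> x) \<partial>lborel) < \<infinity>"
      using K3[of a] a bigK by (auto simp: less_top[symmetric] top_unique)
    fix A :: "real set" and h :: real and n :: nat
    assume A: "A \<in> sets borel" "A \<subseteq> {a..a + 2}" and h: "0 < h" "1 \<le> n" "real n * h \<le> t0"
    define \<alpha> where "\<alpha> = enn2real (\<integral>\<^sup>+ x. indicator A x * ennreal (\<nu> x) \<partial>lborel)"
    have "(\<integral>\<^sup>+ x. indicator A x * ennreal (\<nu> x) \<partial>lborel)
        \<le> (\<integral>\<^sup>+ x. indicator {a..} x * ennreal (\<nu> x) \<partial>lborel)"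
      using A by (intro nn_integral_mono) (auto simp: indicator_def)
    then have "(\<integral>\<^sup>+ x. indicator A x * ennreal (\<nu> x) \<partial>lborel) < \<infinity>"
      using tail_a by (rule le_less_trans)
    then have \<alpha>: "0 \<le> \<alpha>" "(\<integral>\<^sup>+ x. indicator A x * ennreal (\<nu> x) \<partial>lborel) = ennreal \<alpha>"
      by (auto simp: \<alpha>_def)
    have Pz': "emeasure (P t) {x. z < \<bar>x\<bar>} \<le> ennreal d" if "0 \<le> t" "t \<le> t0" for t
      using P_z[of t z] that z d by (auto intro: order.trans ennreal_leI)
    have half: "emeasure (P t) {x. z / 2 < \<bar>x\<bar>} \<le> ennreal (1 / 2)" if "0 \<le> t" "t \<le> t0" for t
      by (rule order.trans[OF P_z[OF that order_refl] ennreal_leI]) (use d20 in simp)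
    have K_lower: "ennreal ((1 - d) * t) * (\<integral>\<^sup>+ x. \<phi> x * ennreal (\<nu> x) \<partial>lborel) \<le> (\<integral>\<^sup>+ x. \<phi> x \<partial>P t)"
      and K_upper: "(\<integral>\<^sup>+ x. \<phi> x \<partial>P t) \<le> ennreal ((1 + d) * t) * (\<integral>\<^sup>+ x. \<phi> x * ennreal (\<nu> x) \<partial>lborel)"
      if "0 < t" "t \<le> t0" "\<phi> \<in> borel_measurable borel" "\<And>x. x \<le> K1 \<Longrightarrow> \<phi> x = 0" for t \<phi>
      using K1 that by auto
    have shift: "(1 - d) * \<nu> x \<le> \<nu> (x + u) \<and> \<nu> (x + u) \<le> (1 + d) * \<nu> x"
      if "a \<le> x" "\<bar>u\<bar> \<le> 2 * z" for x u
      using K2 that a bigK by auto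
    have a': "8 < a" "K1 < a / 2 - z" "z + 1 \<le> a / 4" using a bigK by auto
    \<comment> \<open>The hypotheses of the fixed-grid context, in its order.\<close>
    note facts = C d(1) d20(2) z(1) Pz' K_lower K_upper shift a' A h(1) h(3) \<alpha>
    have crossing: "chain (absorbed_lindley z) (P h) m (indicator {z<..}) 0 \<le> ennreal d" if "m \<le> n" for m
    proof (rule crossing_prob_le[OF facts _ half that])
      fix k assume "k \<le> n"
      then have "real k * h \<le> real n * h" using h by (intro mult_right_mono) auto
      then have "real k * h \<le> t0" using h by linarith
      then show "chain lindley (P h) k (indicator {z / 2<..}) 0 \<le> ennreal (d / 2)"
        using h by (intro L_z) auto
    qed
    have d2: "d * d \<le> d" "d * \<epsilon> \<le> d" "d * (d * d) \<le> d * d" using d d20 \<epsilon>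
      by (auto intro: mult_left_le)
    have nn: "0 \<le> (1 - \<epsilon>) * (real n * h)" "0 \<le> (1 + \<epsilon>) * (real n * h)" using \<epsilon> h by auto
    have "ennreal ((1 - \<epsilon>) * (real n * h) * \<alpha>) \<le> chain lindley (P h) n (indicator A) 0"
    proof (rule lindley_grid_lower[OF facts crossing[OF order_refl] h(2) less_imp_le[OF \<tau>(1)] _ \<tau>(2)])
      show "(\<integral>\<^sup>+ x. indicator {a / 2 - z..} x * ennreal (\<nu> x) \<partial>lborel) \<le> ennreal \<tau>"
        using a bigK by (intro K3) auto
      have "1 - 20 * d \<le> (1 - d) * ((1 - d) ^ 3 - d)"
      proof -
        have "1 - 3 * d \<le> (1 - d) ^ 3"
          using Bernoulli_inequality[of "-d" 3] d20 by simp
        then have "(1 - d) * (1 - 4 * d) \<le> (1 - d) * ((1 - d) ^ 3 - d)"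
          using d20 by (intro mult_left_mono) auto
        moreover have "1 - 20 * d \<le> (1 - d) * (1 - 4 * d)" using d by (simp add: algebra_simps)
        ultimately show ?thesis by linarith
      qed
      then show "1 - \<epsilon> \<le> (1 - d) * ((1 - d) ^ 3 - d)" using d20 by linarith
    qed (use \<epsilon> in auto)
    then show "ennreal ((1 - \<epsilon>) * (real n * h)) * (\<integral>\<^sup>+ x. indicator A x * ennreal (\<nu> x) \<partial>lborel)
        \<le> chain lindley (P h) n (indicator A) 0"
      using nn \<alpha> by (simp add: ennreal_mult)
    have "chain lindley (P h) n (indicator A) 0 \<le> ennreal ((1 + \<epsilon>) * (real n * h) * \<alpha>)"
    proof (rule lindley_grid_upper[OF facts crossing h(2)])
      have "2 * (C * d) + (1 + d) * (1 + d + C * d) = 2 * (\<epsilon> / 20) + (1 + d) * (1 + d + \<epsilon> / 20)"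
        by (simp add: d)
      also have "\<dots> \<le> 2 * (\<epsilon> / 20) + (1 + \<epsilon> / 20) * (1 + \<epsilon> / 20 + \<epsilon> / 20)"
        using d20 d by (intro add_mono mult_mono) auto
      also have "\<dots> \<le> (1 + \<epsilon>) * (1 - \<epsilon> / 20)"
      proof -
        have "\<epsilon> * \<epsilon> \<le> \<epsilon>" using \<epsilon> by (auto intro: mult_left_le)
        then show ?thesis using \<epsilon> by (simp add: field_simps)
      qed
      also have "\<dots> \<le> (1 + \<epsilon>) * (1 - d)"
        using d20 \<epsilon> by (intro mult_left_mono) auto
      finally show "2 * C * d + (1 + d) * (1 + d + C * d) \<le> (1 + \<epsilon>) * (1 - d)"
        by (simp add: mult.assoc)
    qed
    then show "chain lindley (P h) n (indicator A) 0
        \<le> ennreal ((1 + \<epsilon>) * (real n * h)) * (\<integral>\<^sup>+ x. indicator A x * ennreal (\<nu> x) \<partial>lborel)"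
      using nn \<alpha> by (simp add: ennreal_mult)
  qed
qed

end

section \<open>Grid maxima of a Levy process\<close>

text \<open>One-sided limits bound the path near every point of [0, T], and finitely many of these
  neighbourhoods cover the interval.\<close>

lemma cadlag_bounded:
  assumes "cadlag w"
  shows "\<exists>B. \<forall>s\<in>{0..T}. \<bar>w s\<bar> \<le> B"
proof -
  have "\<exists>U B. open U \<and> s \<in> U \<and> (\<forall>r\<in>U. 0 \<le> r \<longrightarrow> \<bar>w r\<bar> \<le> B)" if "0 \<le> s" for s
  proof -
    have "(w \<longlongrightarrow> w s) (at_right s)" using assms that by (auto simp: cadlag_def)
    then have "eventually (\<lambda>r. \<bar>w r - w s\<bar> < 1) (at_right s)"
      by (auto dest: tendstoD[of _ _ _ 1] simp: dist_real_def)
    then obtain b where b: "s < b" "\<And>r. s < r \<Longrightarrow> r < b \<Longrightarrow> \<bar>w r - w s\<bar> < 1"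
      by (auto simp: eventually_at_right_field)
    obtain a l where a: "a < s" "\<And>r. a < r \<Longrightarrow> r < s \<Longrightarrow> 0 \<le> r \<Longrightarrow> \<bar>w r - l\<bar> < 1"
    \<comment> \<open>There is no left limit at 0, but only nonnegative times have to be bounded, so
      any left end will do.\<close>
    proof (cases "s = 0")
      case True
      then show ?thesis using that[of "-1" 0] by auto
    next
      case False
      with \<open>0 \<le> s\<close> have "0 < s" by simp
      with assms obtain l where "(w \<longlongrightarrow> l) (at_left s)" by (auto simp: cadlag_def)
      then have "eventually (\<lambda>r. \<bar>w r - l\<bar> < 1) (at_left s)"
        by (auto dest: tendstoD[of _ _ _ 1] simp: dist_real_def)
      then show ?thesis using that by (auto simp: eventually_at_left_field)
    qed
    show ?thesis
    proof (intro exI[of _ "{a<..<b}"] exI[of _ "\<bar>w s\<bar> + \<bar>l\<bar> + 1"] conjI ballI impI)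
      fix r assume "r \<in> {a<..<b}" "0 \<le> r"
      then show "\<bar>w r\<bar> \<le> \<bar>w s\<bar> + \<bar>l\<bar> + 1"
        using a(2)[of r] b(2)[of r] by (cases r s rule: linorder_cases) auto
    qed (use a b in auto)
  qed
  then obtain U B where U: "\<And>s. 0 \<le> s \<Longrightarrow> open (U s)" "\<And>s. 0 \<le> s \<Longrightarrow> s \<in> U s"
    and B: "\<And>s r. 0 \<le> s \<Longrightarrow> r \<in> U s \<Longrightarrow> 0 \<le> r \<Longrightarrow> \<bar>w r\<bar> \<le> B s"
    by metis
  have "compact {0..T}" "{0..T} \<subseteq> (\<Union>s\<in>{0..T}. U s)" using U by auto
  then obtain C where C: "C \<subseteq> {0..T}" "finite C" "{0..T} \<subseteq> (\<Union>s\<in>C. U s)"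
    using U(1) by (elim compactE_image[where C = "{0..T}" and f = U]) auto
  show ?thesis
  proof (intro exI ballI)
    fix r assume r: "r \<in> {0..T}"
    then obtain s where s: "s \<in> C" "r \<in> U s" using C by auto
    then have "\<bar>w r\<bar> \<le> B s" using B[of s r] r C by auto
    also have "\<dots> \<le> (\<Sum>s\<in>C. \<bar>B s\<bar>)"
      using member_le_sum[of s C "\<lambda>s. \<bar>B s\<bar>"] s C by auto
    finally show "\<bar>w r\<bar> \<le> (\<Sum>s\<in>C. \<bar>B s\<bar>)" .
  qed
qed

lemma cadlag_right_neighbourhood:
  assumes "cadlag w" "0 \<le> s" "open U" "w s \<in> U"
  obtains b where "s < b" "\<And>r. s < r \<Longrightarrow> r < b \<Longrightarrow> w r \<in> U"
proof -
  have "(w \<longlongrightarrow> w s) (at_right s)" using assms by (auto simp: cadlag_def)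
  then have "eventually (\<lambda>r. w r \<in> U) (at_right s)"
    using assms by (intro topological_tendstoD)
  then show ?thesis using that by (auto simp: eventually_at_right_field)
qed

lemma chain_state_walk: "chain_state (+) n x y = y + (\<Sum>i<n. x i)"
  by (induction n arbitrary: y) (auto simp: algebra_simps)

text \<open>Unrolled, the Lindley state from 0 is the largest sum of the most recently consumed
  steps. With the steps consumed in reverse order these sums are \<open>s k - s 0\<close>, so it is
  the maximum of the path; a start y > 0 only raises the full sum.\<close>

lemma chain_state_lindley:
  fixes s :: "nat \<Rightarrow> real"
  assumes "0 \<le> y"
  shows "chain_state lindley n (\<lambda>i. s (Suc i) - s i) y
    = max (y + s n - s 0) (Max ((\<lambda>k. s k - s 0) ` {..n}))"
  using assms
proof (induction n arbitrary: y)
  case (Suc n)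
  let ?M = "Max ((\<lambda>k. s k - s 0) ` {..n})"
  have "s n - s 0 \<le> ?M" by (intro Max_ge) auto
  moreover have "Max ((\<lambda>k. s k - s 0) ` {..Suc n}) = max (s (Suc n) - s 0) ?M"
    by (simp add: atMost_Suc)
  moreover have "chain_state lindley (Suc n) (\<lambda>i. s (Suc i) - s i) y
      = max (max 0 (y + (s (Suc n) - s n)) + s n - s 0) ?M"
    by (simp only: chain_state.simps Suc.IH[OF lindley_nonneg]) (simp add: lindley_def)
  ultimately show ?case
    using Suc.prems by linarith
qed simp

lemma chain_state_cong: "(\<And>i. i < n \<Longrightarrow> x i = x' i) \<Longrightarrow> chain_state T n x y = chain_state T n x' y"
  by (induction n arbitrary: y) auto

definition grid_max :: "(real \<Rightarrow> 'a \<Rightarrow> real) \<Rightarrow> real \<Rightarrow> nat \<Rightarrow> 'a \<Rightarrow> real" where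
  "grid_max X h n \<omega> = Max ((\<lambda>k. X (real k * h) \<omega>) ` {..n})"

context levy_process
begin

abbreviation law :: "real \<Rightarrow> real measure" where
  "law t \<equiv> distr M borel (X t)"

lemma prob_space_law: "0 \<le> t \<Longrightarrow> prob_space (law t)"
  by (intro prob_space_distr random_variable_X)

lemma measurable_grid_max [measurable]: "0 \<le> h \<Longrightarrow> grid_max X h n \<in> borel_measurable M"
  unfolding grid_max_def[abs_def] by (intro borel_measurable_Max random_variable_X) auto

lemma chain_eq_nn_integral:
  assumes T [measurable]: "case_prod T \<in> borel_measurable (borel \<Otimes>\<^sub>M borel)"
    and [measurable]: "\<phi> \<in> borel_measurable borel" and "0 < h"
  shows "chain T (law h) n \<phi> y =
    (\<integral>\<^sup>+ \<omega>. \<phi> (chain_state T n (\<lambda>i. X (real (Suc i) * h) \<omega> - X (real i * h) \<omega>) y) \<partial>M)"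
\<comment> \<open>The description of independence by a product law requires a nonempty index
  set.\<close>
proof (cases "n = 0")
  case True
  then show ?thesis by (simp add: emeasure_space_1)
next
  case False
  let ?D = "\<lambda>i \<omega>. X (real (Suc i) * h) \<omega> - X (real i * h) \<omega>"
  have rv: "random_variable borel (?D i)" for i
    using \<open>0 < h\<close> by (intro borel_measurable_diff random_variable_X) auto
  have "indep_vars (\<lambda>_. borel) ?D {..<n}"
    using indep_increments[of "\<lambda>i. real i * h" n] \<open>0 < h\<close>
    by (auto simp: incseq_def mult_right_mono)
  then have "distr M (Pi\<^sub>M {..<n} (\<lambda>_. borel)) (\<lambda>\<omega>. \<lambda>i\<in>{..<n}. ?D i \<omega>)
      = (\<Pi>\<^sub>M i\<in>{..<n}. distr M borel (?D i))"
    using False rv by (subst (asm) indep_vars_iff_distr_eq_PiM') auto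
  also have "\<dots> = Pi\<^sub>M {..<n} (\<lambda>_. law h)"
  proof (intro PiM_cong refl)
    fix i
    show "distr M borel (?D i) = law h"
      using stationary_increments[of "real i * h" h] \<open>0 < h\<close> by (simp add: algebra_simps)
  qed
  finally have D: "distr M (Pi\<^sub>M {..<n} (\<lambda>_. borel)) (\<lambda>\<omega>. \<lambda>i\<in>{..<n}. ?D i \<omega>) = Pi\<^sub>M {..<n} (\<lambda>_. law h)" .
  have [measurable]: "(\<lambda>x. chain_state T n x y) \<in> borel_measurable (Pi\<^sub>M {..<n} (\<lambda>_. borel))"
    by (intro measurable_chain_state) auto
  have "chain T (law h) n \<phi> y = (\<integral>\<^sup>+ x. \<phi> (chain_state T n x y) \<partial>Pi\<^sub>M {..<n} (\<lambda>_. law h))"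
    using \<open>0 < h\<close> prob_space_law by (intro nn_integral_chain_state[symmetric]) auto
  also have "\<dots> = (\<integral>\<^sup>+ \<omega>. \<phi> (chain_state T n (\<lambda>i\<in>{..<n}. ?D i \<omega>) y) \<partial>M)"
    unfolding D[symmetric] using rv by (subst nn_integral_distr) auto
  also have "\<dots> = (\<integral>\<^sup>+ \<omega>. \<phi> (chain_state T n (\<lambda>i. ?D i \<omega>) y) \<partial>M)"
    by (intro nn_integral_cong arg_cong[of _ _ \<phi>] chain_state_cong) auto
  finally show ?thesis .
qed

lemma walk_eq_law:
  assumes "0 < h" and [measurable]: "\<phi> \<in> borel_measurable borel"
  shows "chain (+) (law h) m \<phi> y = (\<integral>\<^sup>+ s. \<phi> (y + s) \<partial>law (real m * h))"
proof -
  have "chain (+) (law h) m \<phi> y = (\<integral>\<^sup>+ \<omega>. \<phi> (y + (X (real m * h) \<omega> - X 0 \<omega>)) \<partial>M)"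
    using sum_lessThan_telescope[of "\<lambda>i. X (real i * h) _" m] \<open>0 < h\<close>
    by (simp add: chain_eq_nn_integral chain_state_walk)
  also have "\<dots> = (\<integral>\<^sup>+ \<omega>. \<phi> (y + X (real m * h) \<omega>) \<partial>M)"
    using start_0 by (intro nn_integral_cong_AE) auto
  also have "\<dots> = (\<integral>\<^sup>+ s. \<phi> (y + s) \<partial>law (real m * h))"
    using \<open>0 < h\<close> by (subst nn_integral_distr) (auto intro: random_variable_X)
  finally show ?thesis .
qed

lemma lindley_eq_grid_max:
  assumes "0 < h" and [measurable]: "\<phi> \<in> borel_measurable borel"
  shows "chain lindley (law h) n \<phi> 0 = (\<integral>\<^sup>+ \<omega>. \<phi> (grid_max X h n \<omega>) \<partial>M)"
proof -
  have "chain lindley (law h) n \<phi> 0 = (\<integral>\<^sup>+ \<omega>. \<phi> (chain_state lindley n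
      (\<lambda>i. X (real (Suc i) * h) \<omega> - X (real i * h) \<omega>) 0) \<partial>M)"
    using \<open>0 < h\<close> by (intro chain_eq_nn_integral) auto
  also have "\<dots> = (\<integral>\<^sup>+ \<omega>. \<phi> (grid_max X h n \<omega>) \<partial>M)"
  proof (intro nn_integral_cong_AE, use start_0 in eventually_elim)
    case (elim \<omega>)
    have "X (real n * h) \<omega> \<le> grid_max X h n \<omega>"
      unfolding grid_max_def by (intro Max_ge) auto
    then show ?case
      using elim by (simp add: chain_state_lindley[of 0 n "\<lambda>i. X (real i * h) \<omega>", simplified] grid_max_def max_absorb2)
  qed
  finally show ?thesis .
qed

lemma X_bounded:
  assumes "0 < d"
  shows "\<exists>z. \<exists>B\<in>sets M. emeasure M B \<le> ennreal d \<and> (\<forall>\<omega>\<in>space M - B. \<forall>s\<in>{0..T}. \<bar>X s \<omega>\<bar> \<le> z)"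
proof -
  \<comment> \<open>Rational times make the events G k measurable, and right continuity carries the
    bound to all times. The extra unit leaves rationals to the right of T.\<close>
  define Q where "Q = \<rat> \<inter> {0..T + 1}"
  have "countable Q" by (auto simp: Q_def intro: countable_rat countable_Int1)
  define G where "G k = {\<omega>\<in>space M. \<forall>q\<in>Q. \<bar>X q \<omega>\<bar> \<le> real k}" for k :: nat
  have [measurable]: "G k \<in> sets M" for k
  proof -
    have [measurable]: "X q \<in> borel_measurable M" if "q \<in> Q" for q
      using that by (auto simp: Q_def intro: random_variable_X)
    show ?thesis unfolding G_def using \<open>countable Q\<close> by measurable
  qed
  have "incseq G" by (auto simp: incseq_def G_def intro: order.trans)
  moreover have "(\<Union>k. G k) = space M"
  proof (intro equalityI subsetI)
    fix \<omega> assume \<omega>: "\<omega> \<in> space M"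
    then obtain b where b: "\<And>s. s \<in> {0..T + 1} \<Longrightarrow> \<bar>X s \<omega>\<bar> \<le> b"
      using cadlag_bounded[OF cadlag_paths] by meson
    obtain k :: nat where "b \<le> real k" using real_arch_simple by auto
    then have "\<omega> \<in> G k" using b \<omega> by (force simp: G_def Q_def)
    then show "\<omega> \<in> (\<Union>k. G k)" by auto
  qed (auto simp: G_def)
  ultimately have "(\<lambda>k. prob (G k)) \<longlonglongrightarrow> 1"
    using finite_Lim_measure_incseq[of G] prob_space by (simp add: image_subset_iff)
  then have "eventually (\<lambda>k. 1 - d < prob (G k)) sequentially"
    using assms by (intro order_tendstoD) auto
  then obtain k where k: "1 - d < prob (G k)" by (auto simp: eventually_sequentially)
  show ?thesis
  proof (intro exI[of _ "real k"] bexI[of _ "space M - G k"] conjI ballI)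
    show "emeasure M (space M - G k) \<le> ennreal d"
      using k by (auto simp: emeasure_eq_measure prob_compl intro!: ennreal_leI)
    fix \<omega> s assume "\<omega> \<in> space M - (space M - G k)" and s: "s \<in> {0..T}"
    then have \<omega>: "\<omega> \<in> space M" "\<omega> \<in> G k" by (auto simp: G_def)
    show "\<bar>X s \<omega>\<bar> \<le> real k"
    proof (rule ccontr)
      assume "\<not> \<bar>X s \<omega>\<bar> \<le> real k"
      then have "X s \<omega> \<in> {x. real k < \<bar>x\<bar>}" "0 \<le> s" using s by auto
      moreover have "open {x :: real. real k < \<bar>x\<bar>}"
        by (intro open_Collect_less continuous_intros)
      ultimately obtain b where b: "s < b" "\<And>r. s < r \<Longrightarrow> r < b \<Longrightarrow> X r \<omega> \<in> {x. real k < \<bar>x\<bar>}"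
        using cadlag_right_neighbourhood[OF cadlag_paths[OF \<omega>(1)]] by metis
      obtain q where "q \<in> \<rat>" "s < q" "q < min b (T + 1)"
        using Rats_dense_in_real[of s "min b (T + 1)"] b s by auto
      then have "q \<in> Q" "real k < \<bar>X q \<omega>\<bar>" using b(2)[of q] s by (auto simp: Q_def)
      with \<omega>(2) show False by (auto simp: G_def)
    qed
  qed auto
qed

lemma law_tight:
  assumes "0 < d"
  shows "\<exists>z. \<forall>t\<in>{0..t0}. emeasure (law t) {x. z < \<bar>x\<bar>} \<le> ennreal d"
proof -
  obtain z B where B: "B \<in> sets M" "emeasure M B \<le> ennreal d"
    "\<And>\<omega> s. \<omega> \<in> space M - B \<Longrightarrow> s \<in> {0..t0} \<Longrightarrow> \<bar>X s \<omega>\<bar> \<le> z"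
    using X_bounded[OF assms, of t0] by blast
  show ?thesis
  proof (intro exI ballI)
    fix t assume t: "t \<in> {0..t0}"
    then have "emeasure (law t) {x. z < \<bar>x\<bar>} = emeasure M (X t -` {x. z < \<bar>x\<bar>} \<inter> space M)"
      using random_variable_X by (intro emeasure_distr) auto
    also have "\<dots> \<le> emeasure M B"
    proof (rule emeasure_mono[OF _ B(1)])
      show "X t -` {x. z < \<bar>x\<bar>} \<inter> space M \<subseteq> B"
        using B(3)[of _ t] t by fastforce
    qed
    finally show "emeasure (law t) {x. z < \<bar>x\<bar>} \<le> ennreal d" using B(2) by simp
  qed
qed

lemma lindley_tight_law:
  assumes "0 < d"
  shows "\<exists>z. \<forall>h m. 0 < h \<longrightarrow> real m * h \<le> t0 \<longrightarrow>
    chain lindley (law h) m (indicator {z<..}) 0 \<le> ennreal d"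
proof -
  obtain z B where B: "B \<in> sets M" "emeasure M B \<le> ennreal d"
    "\<And>\<omega> s. \<omega> \<in> space M - B \<Longrightarrow> s \<in> {0..t0} \<Longrightarrow> \<bar>X s \<omega>\<bar> \<le> z"
    using X_bounded[OF assms, of t0] by blast
  show ?thesis
  proof (intro exI allI impI)
    fix h :: real and m :: nat assume h: "0 < h" "real m * h \<le> t0"
    have "chain lindley (law h) m (indicator {z<..}) 0 = (\<integral>\<^sup>+ \<omega>. indicator {z<..} (grid_max X h m \<omega>) \<partial>M)"
      using h by (intro lindley_eq_grid_max) auto
    also have "\<dots> \<le> (\<integral>\<^sup>+ \<omega>. indicator B \<omega> \<partial>M)"
    proof (rule nn_integral_mono)
      fix \<omega> assume \<omega>: "\<omega> \<in> space M"
      show "indicator {z<..} (grid_max X h m \<omega>) \<le> (indicator B \<omega> :: ennreal)"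
      proof (cases "\<omega> \<in> B")
        case False
        have "X (real k * h) \<omega> \<le> z" if "k \<le> m" for k
        proof -
          have "real k * h \<le> real m * h" using that h by (intro mult_right_mono) auto
          then have "real k * h \<le> t0" using h by linarith
          then have "real k * h \<in> {0..t0}" using h by simp
          then show ?thesis using B(3)[of \<omega> "real k * h"] \<omega> False by auto
        qed
        then have "grid_max X h m \<omega> \<le> z"
          unfolding grid_max_def by (intro Max.boundedI) auto
        then show ?thesis by (simp add: indicator_def)
      qed (auto simp: indicator_def)
    qed
    also have "\<dots> \<le> ennreal d" using B by simp
    finally show "chain lindley (law h) m (indicator {z<..}) 0 \<le> ennreal d" .
  qed
qed

text \<open>If the path exceeds l at some s < t, it does so on an interval to the right of s, which
  contains a grid point as soon as the mesh is small. The time s = t is itself a grid point.\<close>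

lemma grid_max_tendsto:
  assumes "\<omega> \<in> space M" "0 < t"
  shows "(\<lambda>n. grid_max X (t / real (Suc n)) (Suc n) \<omega>) \<longlonglongrightarrow> running_sup X t \<omega>"
proof -
  obtain b where b: "\<And>s. s \<in> {0..t} \<Longrightarrow> \<bar>X s \<omega>\<bar> \<le> b"
    using cadlag_bounded[OF cadlag_paths[OF assms(1)]] by meson
  then have bdd: "bdd_above ((\<lambda>s. X s \<omega>) ` {0..t})"
    by (intro bdd_aboveI2[of _ _ b]) force
  have grid: "real k * (t / real (Suc n)) \<in> {0..t}" if "k \<le> Suc n" for k n
  proof -
    have "real k * (t / real (Suc n)) \<le> real (Suc n) * (t / real (Suc n))"
      using that assms by (intro mult_right_mono) auto
    then show ?thesis using assms by (auto simp del: of_nat_Suc)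
  qed
  have le: "grid_max X (t / real (Suc n)) (Suc n) \<omega> \<le> running_sup X t \<omega>" for n
    unfolding grid_max_def
  proof (rule Max.boundedI)
    fix x assume "x \<in> (\<lambda>k. X (real k * (t / real (Suc n))) \<omega>) ` {..Suc n}"
    then obtain k where "k \<le> Suc n" "x = X (real k * (t / real (Suc n))) \<omega>" by blast
    then show "x \<le> running_sup X t \<omega>"
      using cSUP_upper[OF grid bdd] by (simp only: running_sup_def)
  qed auto
  show ?thesis
  proof (rule order_tendstoI)
    fix l assume "l < running_sup X t \<omega>"
    then obtain s where s: "0 \<le> s" "s \<le> t" "l < X s \<omega>"
      unfolding running_sup_def by (subst (asm) less_cSUP_iff) (use assms bdd in auto)
    have "eventually (\<lambda>n. \<exists>k\<le>Suc n. l < X (real k * (t / real (Suc n))) \<omega>) sequentially"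
    proof (cases "s = t")
      case True
      have "real (Suc n) * (t / real (Suc n)) = t" for n by (simp del: of_nat_Suc)
      then show ?thesis using s True by (intro always_eventually allI) (metis order_refl)
    next
      case False
      obtain c where c: "s < c" "\<And>r. s < r \<Longrightarrow> r < c \<Longrightarrow> X r \<omega> \<in> {l<..}"
        using cadlag_right_neighbourhood[OF cadlag_paths[OF assms(1)] s(1), of "{l<..}"] s by auto
      have "(\<lambda>n. t / real (Suc n)) \<longlonglongrightarrow> 0"
        using LIMSEQ_Suc[OF lim_const_over_n[of t]] by simp
      then have "eventually (\<lambda>n. t / real (Suc n) < c - s) sequentially"
        using c by (intro order_tendstoD) auto
      then show ?thesis
      proof eventually_elim
        case (elim n)
        define N where "N = real (Suc n)"
        have N: "0 < N" by (simp add: N_def)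
        \<comment> \<open>The index of the first grid point strictly after s; that point is at most
          one mesh width away and hence before c.\<close>
        define k where "k = nat \<lfloor>s * N / t\<rfloor> + 1"
        have k: "s * N / t < real k" "real k \<le> s * N / t + 1"
          using s assms N by (auto simp: k_def) linarith+
        have "s * N / t < N" using s False assms N by (simp add: field_simps)
        then have "real k < N + 1" using k by linarith
        then have "k \<le> Suc n" by (simp add: N_def)
        moreover have "s < real k * (t / N)" "real k * (t / N) \<le> s + t / N"
          using k assms N by (auto simp: field_simps)
        then have "l < X (real k * (t / N)) \<omega>" using c(2)[of "real k * (t / N)"] elim by (simp add: N_def)
        ultimately show ?case by (auto simp: N_def)
      qed
    qed
    then show "eventually (\<lambda>n. l < grid_max X (t / real (Suc n)) (Suc n) \<omega>) sequentially"
    proof eventually_elim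
      case (elim n)
      then show ?case unfolding grid_max_def by (subst Max_gr_iff) auto
    qed
  next
    fix u assume "running_sup X t \<omega> < u"
    then show "eventually (\<lambda>n. grid_max X (t / real (Suc n)) (Suc n) \<omega> < u) sequentially"
      by (intro always_eventually allI le_less_trans[OF le])
  qed
qed

lemma measurable_running_sup: "0 < t \<Longrightarrow> running_sup X t \<in> borel_measurable M"
  by (rule borel_measurable_LIMSEQ_real[OF grid_max_tendsto]) auto

text \<open>The open half of the portmanteau theorem, by Fatou: where the supremum lies in U, the
  grid maxima eventually do.\<close>

lemma running_sup_open_le:
  assumes "0 < t" "open U" and c: "\<And>n. chain lindley (law (t / real (Suc n))) (Suc n) (indicator U) 0 \<le> c"
  shows "emeasure (distr M borel (running_sup X t)) U \<le> c"
proof -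
  have [measurable]: "U \<in> sets borel" using assms by simp
  let ?g = "\<lambda>n \<omega>. indicator U (grid_max X (t / real (Suc n)) (Suc n) \<omega>) :: ennreal"
  have g [measurable]: "?g n \<in> borel_measurable M" for n
    using assms by (intro measurable_compose[OF measurable_grid_max]) auto
  have "emeasure (distr M borel (running_sup X t)) U = (\<integral>\<^sup>+ \<omega>. indicator U (running_sup X t \<omega>) \<partial>M)"
    using measurable_running_sup[OF assms(1)]
    by (subst nn_integral_distr[symmetric]) auto
  also have "\<dots> \<le> (\<integral>\<^sup>+ \<omega>. liminf (\<lambda>n. ?g n \<omega>) \<partial>M)"
  proof (rule nn_integral_mono)
    fix \<omega> assume \<omega>: "\<omega> \<in> space M"
    show "indicator U (running_sup X t \<omega>) \<le> liminf (\<lambda>n. ?g n \<omega>)"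
    proof (cases "running_sup X t \<omega> \<in> U")
      case True
      then have "eventually (\<lambda>n. grid_max X (t / real (Suc n)) (Suc n) \<omega> \<in> U) sequentially"
        by (rule topological_tendstoD[OF grid_max_tendsto[OF \<omega> assms(1)] assms(2)])
      then have "eventually (\<lambda>n. 1 \<le> ?g n \<omega>) sequentially"
        by eventually_elim simp
      then show ?thesis using True by (simp add: Liminf_bounded)
    qed simp
  qed
  also have "\<dots> \<le> liminf (\<lambda>n. \<integral>\<^sup>+ \<omega>. ?g n \<omega> \<partial>M)"
    by (intro nn_integral_liminf g)
  also have "\<dots> = liminf (\<lambda>n. chain lindley (law (t / real (Suc n))) (Suc n) (indicator U) 0)"
    using assms by (subst lindley_eq_grid_max) auto
  also have "\<dots> \<le> liminf (\<lambda>n. c)"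
    by (intro Liminf_mono always_eventually allI c)
  finally show ?thesis by (simp add: Liminf_const)
qed

text \<open>The closed half, by passing to complements.\<close>

lemma running_sup_closed_ge:
  assumes t: "0 < t" and F: "closed F" and "0 \<le> c"
    and c: "\<And>n. ennreal c \<le> chain lindley (law (t / real (Suc n))) (Suc n) (indicator F) 0"
  shows "ennreal c \<le> emeasure (distr M borel (running_sup X t)) F"
proof -
  interpret S: prob_space "distr M borel (running_sup X t)"
    by (intro prob_space_distr measurable_running_sup t)
  have [measurable]: "F \<in> sets borel" using F by simp
  have "emeasure (distr M borel (running_sup X t)) (- F) \<le> ennreal (1 - c)"
  proof (rule running_sup_open_le[OF t])
    show "open (- F)" using F by auto
    fix n
    let ?\<mu> = "law (t / real (Suc n))"
    have "chain lindley ?\<mu> (Suc n) (indicator F) 0 + chain lindley ?\<mu> (Suc n) (indicator (- F)) 0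
        = chain lindley ?\<mu> (Suc n) (\<lambda>x. indicator F x + indicator (- F) x) 0"
      using t by (intro chain_add[symmetric] prob_space_law) auto
    also have "(\<lambda>x. indicator F x + indicator (- F) x :: ennreal) = (\<lambda>_. 1)"
      by (auto simp: indicator_def fun_eq_iff)
    also have "chain lindley ?\<mu> (Suc n) (\<lambda>_. 1) 0 = 1"
      using t by (intro chain_const prob_space_law) auto
    finally have "ennreal c + chain lindley ?\<mu> (Suc n) (indicator (- F)) 0 \<le> 1"
      using c[of n] by (metis add_right_mono)
    then show "chain lindley ?\<mu> (Suc n) (indicator (- F)) 0 \<le> ennreal (1 - c)"
      using \<open>0 \<le> c\<close>
      by (cases "chain lindley ?\<mu> (Suc n) (indicator (- F)) 0")
        (auto simp: top_unique ennreal_le_iff2 simp flip: ennreal_plus)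
  qed
  moreover have "c \<le> 1"
  proof -
    have "ennreal c \<le> 1"
      using t by (intro order.trans[OF c[of 0]] chain_le_1 prob_space_law) (auto simp: indicator_def)
    then show ?thesis by simp
  qed
  ultimately have "S.prob (- F) \<le> 1 - c"
    by (simp add: S.emeasure_eq_measure)
  moreover have "S.prob (- F) = 1 - S.prob F"
    using S.prob_compl[of F] by (simp add: Compl_eq_Diff_UNIV)
  ultimately show ?thesis by (simp add: S.emeasure_eq_measure ennreal_leI)
qed

end

section \<open>Densities from bounds on open and closed sets\<close>

text \<open>\<open>density \<mu> (indicator S)\<close> is the restriction of \<mu> to S kept as a
  measure on the whole line. As a measure with a density it equals \<open>density lborel g'\<close>,
  which extends the identity from sets to functions.\<close>

lemma has_density_on_nn_integral:
  assumes dens: "has_density_on \<mu> S g" and [measurable]: "S \<in> sets borel" "\<phi> \<in> borel_measurable borel"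
    and [measurable_cong]: "sets \<mu> = sets borel" and vanish: "\<And>x. x \<notin> S \<Longrightarrow> \<phi> x = 0"
  shows "(\<integral>\<^sup>+ x. \<phi> x \<partial>\<mu>) = (\<integral>\<^sup>+ x. \<phi> x * ennreal (g x) \<partial>lborel)"
proof -
  define g' where "g' x = ennreal (indicator S x *\<^sub>R g x)" for x
  have [measurable]: "g' \<in> borel_measurable borel"
    using dens by (auto simp: g'_def[abs_def] has_density_on_def set_borel_measurable_def)
  have "density \<mu> (indicator S) = density lborel g'"
  proof (rule measure_eqI)
    fix A assume "A \<in> sets (density \<mu> (indicator S))"
    then have [measurable]: "A \<in> sets borel" by (simp add: assms)
    have "emeasure (density \<mu> (indicator S)) A = (\<integral>\<^sup>+ x. indicator (S \<inter> A) x \<partial>\<mu>)"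
      by (simp add: emeasure_density indicator_inter_arith)
    also have "\<dots> = emeasure \<mu> (S \<inter> A)"
      by (rule nn_integral_indicator) measurable
    also have "\<dots> = (\<integral>\<^sup>+ x\<in>S \<inter> A. ennreal (g x) \<partial>lborel)"
      using dens by (simp add: has_density_on_def)
    also have "\<dots> = emeasure (density lborel g') A"
      by (subst emeasure_density) (auto intro!: nn_integral_cong simp: indicator_def g'_def)
    finally show "emeasure (density \<mu> (indicator S)) A = emeasure (density lborel g') A" .
  qed (simp add: assms)
  then have "(\<integral>\<^sup>+ x. \<phi> x \<partial>density \<mu> (indicator S)) = (\<integral>\<^sup>+ x. \<phi> x \<partial>density lborel g')"
    by simp
  then have "(\<integral>\<^sup>+ x. indicator S x * \<phi> x \<partial>\<mu>) = (\<integral>\<^sup>+ x. g' x * \<phi> x \<partial>lborel)"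
    by (simp add: nn_integral_density)
  also have "(\<lambda>x. indicator S x * \<phi> x) = \<phi>"
    using vanish by (auto simp: indicator_def fun_eq_iff)
  also have "(\<lambda>x. g' x * \<phi> x) = (\<lambda>x. \<phi> x * ennreal (g x))"
    using vanish by (auto simp: indicator_def fun_eq_iff g'_def mult.commute)
  finally show ?thesis .
qed

lemma has_density_on_cong_AE:
  assumes "has_density_on \<mu> S f" "set_borel_measurable borel S g" "\<And>x. x \<in> S \<Longrightarrow> 0 \<le> g x"
    and "AE x in lborel. x \<in> S \<longrightarrow> g x = f x"
  shows "has_density_on \<mu> S g"
  unfolding has_density_on_def
proof (intro conjI ballI impI)
  fix A assume A: "A \<in> sets borel" "A \<subseteq> S"
  then have "emeasure \<mu> A = (\<integral>\<^sup>+ x\<in>A. ennreal (f x) \<partial>lborel)"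
    using assms(1) by (simp add: has_density_on_def)
  also have "\<dots> = (\<integral>\<^sup>+ x\<in>A. ennreal (g x) \<partial>lborel)"
    using assms(4) A by (intro nn_integral_cong_AE) (auto simp: indicator_def)
  finally show "emeasure \<mu> A = (\<integral>\<^sup>+ x\<in>A. ennreal (g x) \<partial>lborel)" .
qed (use assms in auto)

text \<open>Tested on the set where \<open>v < u\<close>: were it not null, the integrals over it
  would be strictly ordered the wrong way. Strictness relies on the smaller integral being
  finite.\<close>

lemma AE_le_of_set_integrals:
  fixes u v :: "'a \<Rightarrow> ennreal"
  assumes [measurable]: "u \<in> borel_measurable M" "v \<in> borel_measurable M" "I \<in> sets M"
    and le: "\<And>B. B \<in> sets M \<Longrightarrow> B \<subseteq> I \<Longrightarrow> (\<integral>\<^sup>+ x\<in>B. u x \<partial>M) \<le> (\<integral>\<^sup>+ x\<in>B. v x \<partial>M)"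
    and fin: "(\<integral>\<^sup>+ x\<in>I. v x \<partial>M) < \<infinity>"
  shows "AE x in M. x \<in> I \<longrightarrow> u x \<le> v x"
proof -
  define B where "B = {x\<in>space M. x \<in> I \<and> v x < u x}"
  have B [measurable]: "B \<in> sets M" "B \<subseteq> I" unfolding B_def by auto
  have "AE x in M. u x * indicator B x \<le> v x * indicator B x"
  proof (rule ccontr)
    assume *: "\<not> (AE x in M. u x * indicator B x \<le> v x * indicator B x)"
    have "(\<integral>\<^sup>+ x\<in>B. v x \<partial>M) \<le> (\<integral>\<^sup>+ x\<in>I. v x \<partial>M)"
      using B by (intro nn_integral_mono) (auto simp: indicator_def)
    with fin have "(\<integral>\<^sup>+ x\<in>B. v x \<partial>M) \<noteq> \<infinity>" by auto
    moreover have "AE x in M. v x * indicator B x \<le> u x * indicator B x"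
      by (intro AE_I2) (auto simp: B_def indicator_def)
    ultimately have "(\<integral>\<^sup>+ x\<in>B. v x \<partial>M) < (\<integral>\<^sup>+ x\<in>B. u x \<partial>M)"
      using * by (intro nn_integral_less) auto
    with le[OF B] show False by auto
  qed
  with AE_space show ?thesis
  proof eventually_elim
    case (elim x)
    then show ?case by (cases "x \<in> B") (auto simp: B_def not_less)
  qed
qed

section \<open>Pointwise bounds on a density by regularity of measures\<close>

context
  fixes \<mu> :: "real measure" and f w :: "real \<Rightarrow> real" and S I :: "real set"
  assumes sets_\<mu> [measurable_cong]: "sets \<mu> = sets borel" and \<mu>: "finite_measure \<mu>"
    and dens: "has_density_on \<mu> S f" and S [measurable]: "S \<in> sets borel"
    and I: "open I" "I \<subseteq> S"
    and [measurable]: "w \<in> borel_measurable borel" and w_nonneg: "\<And>x. 0 \<le> w x"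
    and w_fin: "(\<integral>\<^sup>+ x\<in>I. ennreal (w x) \<partial>lborel) < \<infinity>"
begin

lemma domain_in_borel [measurable]: "I \<in> sets borel"
  using I by simp

lemma measurable_density_on [measurable]: "(\<lambda>x. indicator S x * f x) \<in> borel_measurable borel"
  using dens by (simp add: has_density_on_def set_borel_measurable_def)

text \<open>The comparison density w on I as a finite Borel measure on the line, so that the
  regularity theorems apply to it.\<close>

definition weight_measure :: "real measure" where
  "weight_measure = density lborel (\<lambda>x. ennreal (w x) * indicator I x)"

lemma sets_weight_measure: "sets weight_measure = sets borel"
  by (simp add: weight_measure_def)

lemma emeasure_weight_measure: "A \<in> sets borel \<Longrightarrow> A \<subseteq> I \<Longrightarrow> emeasure weight_measure A = (\<integral>\<^sup>+ x\<in>A. ennreal (w x) \<partial>lborel)"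
  unfolding weight_measure_def by (subst emeasure_density) (auto intro!: nn_integral_cong simp: indicator_def)

lemma finite_weight_measure: "emeasure weight_measure (space weight_measure) \<noteq> \<infinity>"
proof -
  have "emeasure weight_measure (space weight_measure) = (\<integral>\<^sup>+ x\<in>I. ennreal (w x) \<partial>lborel)"
    unfolding weight_measure_def by (subst emeasure_density) auto
  then show ?thesis using w_fin by auto
qed

lemma density_integral:
  assumes "A \<in> sets borel" "A \<subseteq> I"
  shows "(\<integral>\<^sup>+ x\<in>A. ennreal (indicator S x * f x) \<partial>lborel) = emeasure \<mu> A"
proof -
  have "A \<subseteq> S" using assms I by auto
  then have "(\<integral>\<^sup>+ x\<in>A. ennreal (indicator S x * f x) \<partial>lborel) = (\<integral>\<^sup>+ x\<in>A. ennreal (f x) \<partial>lborel)"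
    by (intro nn_integral_cong) (auto split: split_indicator)
  with dens assms \<open>A \<subseteq> S\<close> show ?thesis by (simp add: has_density_on_def)
qed

text \<open>Outer regularity is applied to the larger measure, the weight; \<mu> enters only by
  monotonicity. The sets U are cut with I because the hypothesis speaks of subsets of I.\<close>

lemma density_le_of_open:
  assumes "\<And>U. open U \<Longrightarrow> U \<subseteq> I \<Longrightarrow> emeasure \<mu> U \<le> (\<integral>\<^sup>+ x\<in>U. ennreal (w x) \<partial>lborel)"
  shows "AE x in lborel. x \<in> I \<longrightarrow> f x \<le> w x"
proof -
  have "AE x in lborel. x \<in> I \<longrightarrow> ennreal (indicator S x * f x) \<le> ennreal (w x)"
  proof (rule AE_le_of_set_integrals)
    fix B :: "real set" assume B: "B \<in> sets lborel" "B \<subseteq> I"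
    have "emeasure \<mu> B \<le> emeasure weight_measure U" if "B \<subseteq> U" "open U" for U
    proof -
      have UI: "open (U \<inter> I)" "U \<inter> I \<subseteq> I" using that I by auto
      have "emeasure \<mu> B \<le> emeasure \<mu> (U \<inter> I)"
        using that B UI by (intro emeasure_mono) (auto simp: sets_\<mu>)
      also have "\<dots> \<le> emeasure weight_measure (U \<inter> I)"
        using assms[OF UI] UI by (simp add: emeasure_weight_measure)
      also have "\<dots> \<le> emeasure weight_measure U"
        using that by (intro emeasure_mono) (auto simp: sets_weight_measure)
      finally show ?thesis .
    qed
    then have "emeasure \<mu> B \<le> emeasure weight_measure B"
      using B by (subst outer_regular[OF sets_weight_measure finite_weight_measure]) (auto intro!: INF_greatest)
    then show "(\<integral>\<^sup>+ x\<in>B. ennreal (indicator S x * f x) \<partial>lborel) \<le> (\<integral>\<^sup>+ x\<in>B. ennreal (w x) \<partial>lborel)"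
      using B by (simp add: density_integral emeasure_weight_measure)
  qed (use w_fin in auto)
  then show ?thesis
    by eventually_elim (use I w_nonneg in \<open>auto simp: indicator_def ennreal_le_iff\<close>)
qed

text \<open>Now the weight is the smaller measure, so inner regularity is applied to it; compact
  subsets of I are closed.\<close>

lemma density_ge_of_closed:
  assumes "\<And>F. closed F \<Longrightarrow> F \<subseteq> I \<Longrightarrow> (\<integral>\<^sup>+ x\<in>F. ennreal (w x) \<partial>lborel) \<le> emeasure \<mu> F"
  shows "AE x in lborel. x \<in> I \<longrightarrow> w x \<le> f x"
proof -
  have "AE x in lborel. x \<in> I \<longrightarrow> ennreal (w x) \<le> ennreal (indicator S x * f x)"
  proof (rule AE_le_of_set_integrals)
    fix B :: "real set" assume B: "B \<in> sets lborel" "B \<subseteq> I"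
    have "emeasure weight_measure F \<le> emeasure \<mu> B" if "F \<subseteq> B" "compact F" for F
    proof -
      have F: "closed F" "F \<subseteq> I" using that B by (auto intro: compact_imp_closed)
      then have "emeasure weight_measure F \<le> emeasure \<mu> F"
        using assms[OF F] by (simp add: emeasure_weight_measure)
      also have "\<dots> \<le> emeasure \<mu> B"
        using that B by (intro emeasure_mono) (auto simp: sets_\<mu>)
      finally show ?thesis .
    qed
    then have "emeasure weight_measure B \<le> emeasure \<mu> B"
      using B by (subst inner_regular[OF sets_weight_measure finite_weight_measure]) (auto intro!: SUP_least)
    then show "(\<integral>\<^sup>+ x\<in>B. ennreal (w x) \<partial>lborel) \<le> (\<integral>\<^sup>+ x\<in>B. ennreal (indicator S x * f x) \<partial>lborel)"
      using B by (simp add: density_integral emeasure_weight_measure)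
  next
    have "(\<integral>\<^sup>+ x\<in>I. ennreal (indicator S x * f x) \<partial>lborel) = emeasure \<mu> I"
      by (intro density_integral) auto
    then show "(\<integral>\<^sup>+ x\<in>I. ennreal (indicator S x * f x) \<partial>lborel) < \<infinity>"
      using finite_measure.emeasure_finite[OF \<mu>, of I] by (simp add: less_top)
  qed auto
  then show ?thesis
  proof eventually_elim
    case (elim x)
    show ?case
    proof
      assume "x \<in> I"
      moreover from this have "x \<in> S" "0 \<le> f x" using I dens by (auto simp: has_density_on_def)
      ultimately show "w x \<le> f x" using elim by (simp add: ennreal_le_iff)
    qed
  qed
qed

end

text \<open>The chain x / 4, x / 2, x costs one constant for almost-monotonicity and two for
  doubling, hence the cube. The bound x > 4 keeps all points above 1, where c is valid.\<close>

lemma doubling_comparable: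
  fixes \<nu> :: "real \<Rightarrow> real"
  assumes "\<And>x. 0 < x \<Longrightarrow> 0 \<le> \<nu> x" "0 < c"
    and dec: "\<And>x y. 1 < x \<Longrightarrow> x < y \<Longrightarrow> \<nu> y \<le> c * \<nu> x"
    and dbl: "\<And>x. 1 < x \<Longrightarrow> \<nu> x \<le> c * \<nu> (2 * x)"
  shows "\<exists>C\<ge>1. \<forall>x y. 4 < x \<longrightarrow> x / 4 \<le> y \<longrightarrow> \<nu> y \<le> C * \<nu> x"
proof (intro exI[of _ "max 1 c ^ 3"] conjI allI impI)
  fix x y :: real assume xy: "4 < x" "x / 4 \<le> y"
  define C where "C = max 1 c"
  have C: "1 \<le> C" "c \<le> C" by (auto simp: C_def)
  have mono: "c * \<nu> u \<le> C * \<nu> u" "\<nu> u \<le> C * \<nu> u" if "0 < u" for u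
    using C assms(1)[OF that] by (auto intro: mult_right_mono mult_le_cancel_right1[THEN iffD2])
  have "\<nu> y \<le> C * \<nu> (x / 4)"
  proof (cases "x / 4 = y")
    case True
    then show ?thesis using mono(2)[of y] xy by simp
  next
    case False
    then have "\<nu> y \<le> c * \<nu> (x / 4)" using xy by (intro dec) auto
    then show ?thesis using mono(1)[of "x / 4"] xy by simp
  qed
  also have "\<nu> (x / 4) \<le> C * \<nu> (x / 2)"
    using dbl[of "x / 4"] mono(1)[of "x / 2"] xy by simp
  also have "\<nu> (x / 2) \<le> C * \<nu> x"
    using dbl[of "x / 2"] mono(1)[of x] xy by simp
  finally show "\<nu> y \<le> max 1 c ^ 3 * \<nu> x"
    using C by (simp add: C_def[symmetric] power3_eq_cube mult.assoc)
qed auto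

section \<open>Transfer of the density asymptotics to the running supremum\<close>

context levy_process
begin

lemma law_tail:
  fixes \<nu> :: "real \<Rightarrow> real" and p :: "real \<Rightarrow> real \<Rightarrow> real"
  assumes p: "\<And>t. 0 < t \<Longrightarrow> has_density_on (law t) {0..} (p t)"
    and [measurable]: "\<nu> \<in> borel_measurable borel"
    and pos: "eventually (\<lambda>x. 0 < \<nu> x) at_top"
    and p_lim: "uniform_limit {0<..t0} (\<lambda>x t. p t x / (t * \<nu> x)) (\<lambda>t. 1) at_top"
    and "0 < d"
  shows "\<exists>K. \<forall>t\<in>{0<..t0}. \<forall>\<phi>\<in>borel_measurable borel. (\<forall>x\<le>K. \<phi> x = 0) \<longrightarrow>
      ennreal ((1 - d) * t) * (\<integral>\<^sup>+ x. \<phi> x * ennreal (\<nu> x) \<partial>lborel) \<le> (\<integral>\<^sup>+ x. \<phi> x \<partial>law t) \<and>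
      (\<integral>\<^sup>+ x. \<phi> x \<partial>law t) \<le> ennreal ((1 + d) * t) * (\<integral>\<^sup>+ x. \<phi> x * ennreal (\<nu> x) \<partial>lborel)"
proof -
  have "eventually (\<lambda>x. 0 < \<nu> x \<and> (\<forall>t\<in>{0<..t0}. dist (p t x / (t * \<nu> x)) 1 < d)) at_top"
    using pos p_lim \<open>0 < d\<close> by (auto simp: uniform_limit_iff intro: eventually_conj)
  then obtain K0 where "\<forall>x\<ge>K0. 0 < \<nu> x \<and> (\<forall>t\<in>{0<..t0}. dist (p t x / (t * \<nu> x)) 1 < d)"
    unfolding eventually_at_top_linorder ..
  then have K0: "\<And>x. K0 \<le> x \<Longrightarrow> 0 < \<nu> x"
    "\<And>x t. K0 \<le> x \<Longrightarrow> t \<in> {0<..t0} \<Longrightarrow> dist (p t x / (t * \<nu> x)) 1 < d"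
    by blast+
  have bounds: "(1 - d) * t * \<nu> x \<le> p t x" "p t x \<le> (1 + d) * t * \<nu> x"
    if "K0 \<le> x" "t \<in> {0<..t0}" for x t
  proof -
    have pos: "0 < t * \<nu> x" using K0(1) that by auto
    define r where "r = p t x / (t * \<nu> x)"
    have "\<bar>r - 1\<bar> < d" using K0(2)[OF that] by (simp add: dist_real_def r_def)
    then have "1 - d \<le> r" "r \<le> 1 + d" by auto
    then show "(1 - d) * t * \<nu> x \<le> p t x" "p t x \<le> (1 + d) * t * \<nu> x"
      using pos by (simp_all only: r_def pos_le_divide_eq pos_divide_le_eq mult.assoc)
  qed
  show ?thesis
  \<comment> \<open>The maximum with 0 confines \<phi> to the region where X t has a
    density.\<close>
  proof (intro exI[of _ "max 0 K0"] ballI impI)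
    fix t and \<phi> :: "real \<Rightarrow> ennreal"
    assume t: "t \<in> {0<..t0}" and [measurable]: "\<phi> \<in> borel_measurable borel"
      and \<phi>: "\<forall>x\<le>max 0 K0. \<phi> x = 0"
    have eq: "(\<integral>\<^sup>+ x. \<phi> x \<partial>law t) = (\<integral>\<^sup>+ x. \<phi> x * ennreal (p t x) \<partial>lborel)"
      by (rule has_density_on_nn_integral[OF p[of t]]) (use t \<phi> in auto)
    have cmult: "ennreal r * (\<integral>\<^sup>+ x. \<phi> x * ennreal (\<nu> x) \<partial>lborel)
        = (\<integral>\<^sup>+ x. \<phi> x * (ennreal r * ennreal (\<nu> x)) \<partial>lborel)" for r
      by (subst nn_integral_cmult[symmetric]) (auto simp: ac_simps)
    have le: "ennreal ((1 - d) * t) * ennreal (\<nu> x) \<le> ennreal (p t x)"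
      "ennreal (p t x) \<le> ennreal ((1 + d) * t) * ennreal (\<nu> x)" if "max 0 K0 < x" for x
    proof -
      have "0 < \<nu> x" using that by (intro K0) auto
      then have eq: "ennreal r * ennreal (\<nu> x) = ennreal (r * \<nu> x)" for r
        by (simp add: ennreal_mult'')
      show "ennreal ((1 - d) * t) * ennreal (\<nu> x) \<le> ennreal (p t x)"
        "ennreal (p t x) \<le> ennreal ((1 + d) * t) * ennreal (\<nu> x)"
        unfolding eq using bounds[of x t] that t by (simp_all add: ennreal_leI)
    qed
    show "ennreal ((1 - d) * t) * (\<integral>\<^sup>+ x. \<phi> x * ennreal (\<nu> x) \<partial>lborel) \<le> (\<integral>\<^sup>+ x. \<phi> x \<partial>law t) \<and>
      (\<integral>\<^sup>+ x. \<phi> x \<partial>law t) \<le> ennreal ((1 + d) * t) * (\<integral>\<^sup>+ x. \<phi> x * ennreal (\<nu> x) \<partial>lborel)"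
      unfolding eq cmult
    proof (intro conjI nn_integral_mono)
      fix x
      consider "\<phi> x = 0" | "max 0 K0 < x" using \<phi> not_le by blast
      note cases = this
      from cases show "\<phi> x * (ennreal ((1 - d) * t) * ennreal (\<nu> x)) \<le> \<phi> x * ennreal (p t x)"
        by cases (simp_all add: mult_left_mono le)
      from cases show "\<phi> x * ennreal (p t x) \<le> \<phi> x * (ennreal ((1 + d) * t) * ennreal (\<nu> x))"
        by cases (simp_all add: mult_left_mono le)
    qed
  qed
qed

text \<open>K is chosen before t and before the version f of the density, which is the source of the
  uniformity in t; only the exceptional null set may depend on them.\<close>

lemma running_sup_density_bounds:
  fixes \<nu> :: "real \<Rightarrow> real"
  assumes "regular_tail_semigroup law \<nu> t0" and \<epsilon>: "0 < \<epsilon>" "\<epsilon> \<le> 1"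
  shows "\<exists>K>0. \<forall>t f. 0 < t \<longrightarrow> t \<le> t0 \<longrightarrow> has_density_on (distr M borel (running_sup X t)) {0<..} f \<longrightarrow>
    (AE x in lborel. K < x \<longrightarrow> \<bar>f x - t * \<nu> x\<bar> \<le> \<epsilon> * (t * \<nu> x))"
proof -
  interpret regular_tail_semigroup law \<nu> t0 by fact
  obtain K where K: "0 < K" "\<forall>a\<ge>K. (\<integral>\<^sup>+ x. indicator {a..} x * ennreal (\<nu> x) \<partial>lborel) < \<infinity> \<and>
    (\<forall>A h n. A \<in> sets borel \<longrightarrow> A \<subseteq> {a..a + 2} \<longrightarrow> 0 < h \<longrightarrow> 1 \<le> n \<longrightarrow> real n * h \<le> t0 \<longrightarrow>
      ennreal ((1 - \<epsilon>) * (real n * h)) * (\<integral>\<^sup>+ x. indicator A x * ennreal (\<nu> x) \<partial>lborel)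
        \<le> chain lindley (law h) n (indicator A) 0 \<and>
      chain lindley (law h) n (indicator A) 0
        \<le> ennreal ((1 + \<epsilon>) * (real n * h)) * (\<integral>\<^sup>+ x. indicator A x * ennreal (\<nu> x) \<partial>lborel))"
    using lindley_grid_asymptotics[OF \<epsilon>] by (elim exE conjE)
  show ?thesis
  proof (intro exI[of _ "K + 1"] conjI allI impI)
    fix t f
    assume t: "0 < t" "t \<le> t0" and f: "has_density_on (distr M borel (running_sup X t)) {0<..} f"
    have rs: "running_sup X t \<in> borel_measurable M" using t by (intro measurable_running_sup)
    interpret S: prob_space "distr M borel (running_sup X t)" using rs by (rule prob_space_distr)
    have local: "AE x in lborel. x \<in> {a<..<a + 2} \<longrightarrow> \<bar>f x - t * \<nu> x\<bar> \<le> \<epsilon> * (t * \<nu> x)" if "K \<le> a" for a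
    proof -
      have N: "(\<integral>\<^sup>+ x. indicator {a..} x * ennreal (\<nu> x) \<partial>lborel) < \<infinity>"
        using K that by auto
      have cmult: "(\<integral>\<^sup>+ x\<in>A. ennreal (r * t * \<nu> x) \<partial>lborel)
          = ennreal (r * t) * (\<integral>\<^sup>+ x. indicator A x * ennreal (\<nu> x) \<partial>lborel)"
        if "0 \<le> r" "A \<in> sets borel" for r and A :: "real set"
        using that t \<nu>_nonneg
        by (subst nn_integral_cmult[symmetric]) (auto simp: ennreal_mult ac_simps)
      have fin: "(\<integral>\<^sup>+ x\<in>{a<..<a + 2}. ennreal (r * t * \<nu> x) \<partial>lborel) < \<infinity>" if "0 \<le> r" for r
      proof -
        have "(\<integral>\<^sup>+ x. indicator {a<..<a + 2} x * ennreal (\<nu> x) \<partial>lborel)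
            \<le> (\<integral>\<^sup>+ x. indicator {a..} x * ennreal (\<nu> x) \<partial>lborel)"
          by (intro nn_integral_mono) (auto split: split_indicator)
        with N have "(\<integral>\<^sup>+ x. indicator {a<..<a + 2} x * ennreal (\<nu> x) \<partial>lborel) < \<infinity>"
          by (rule le_less_trans[rotated])
        then show ?thesis using that by (simp add: cmult ennreal_mult_less_top)
      qed
      have grid: "ennreal ((1 - \<epsilon>) * t) * (\<integral>\<^sup>+ x. indicator A x * ennreal (\<nu> x) \<partial>lborel)
          \<le> chain lindley (law (t / real (Suc n))) (Suc n) (indicator A) 0"
        "chain lindley (law (t / real (Suc n))) (Suc n) (indicator A) 0
          \<le> ennreal ((1 + \<epsilon>) * t) * (\<integral>\<^sup>+ x. indicator A x * ennreal (\<nu> x) \<partial>lborel)"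
        if "A \<in> sets borel" "A \<subseteq> {a<..<a + 2}" for A n
      proof -
        have A: "A \<subseteq> {a..a + 2}" using that by auto
        have eq: "real (Suc n) * (t / real (Suc n)) = t" by (simp del: of_nat_Suc)
        have h: "0 < t / real (Suc n)" "1 \<le> Suc n" "real (Suc n) * (t / real (Suc n)) \<le> t0"
          unfolding eq using t by auto
        note K(2)[rule_format, OF \<open>K \<le> a\<close>, THEN conjunct2, rule_format, OF that(1) A h]
        then show "ennreal ((1 - \<epsilon>) * t) * (\<integral>\<^sup>+ x. indicator A x * ennreal (\<nu> x) \<partial>lborel)
            \<le> chain lindley (law (t / real (Suc n))) (Suc n) (indicator A) 0"
          "chain lindley (law (t / real (Suc n))) (Suc n) (indicator A) 0
            \<le> ennreal ((1 + \<epsilon>) * t) * (\<integral>\<^sup>+ x. indicator A x * ennreal (\<nu> x) \<partial>lborel)"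
          unfolding eq by (rule conjunct1, rule conjunct2)
      qed
      have sub: "{a<..<a + 2} \<subseteq> {0<..}" using K that by auto
      have "AE x in lborel. x \<in> {a<..<a + 2} \<longrightarrow> f x \<le> (1 + \<epsilon>) * t * \<nu> x"
      proof (rule density_le_of_open[OF _ S.finite_measure_axioms f _ _ sub _ _ fin])
        fix U :: "real set" assume U: "open U" "U \<subseteq> {a<..<a + 2}"
        then show "emeasure (distr M borel (running_sup X t)) U
            \<le> (\<integral>\<^sup>+ x\<in>U. ennreal ((1 + \<epsilon>) * t * \<nu> x) \<partial>lborel)"
          using \<epsilon> by (subst cmult) (auto intro!: running_sup_open_le t grid)
      qed (use \<epsilon> t \<nu>_nonneg in auto)
      moreover have "AE x in lborel. x \<in> {a<..<a + 2} \<longrightarrow> (1 - \<epsilon>) * t * \<nu> x \<le> f x"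
      proof (rule density_ge_of_closed[OF _ S.finite_measure_axioms f _ _ sub _ _ fin])
        fix F :: "real set" assume F: "closed F" "F \<subseteq> {a<..<a + 2}"
        then have "F \<in> sets borel" by simp
        let ?N = "\<integral>\<^sup>+ x. indicator F x * ennreal (\<nu> x) \<partial>lborel"
        have "?N \<le> (\<integral>\<^sup>+ x. indicator {a..} x * ennreal (\<nu> x) \<partial>lborel)"
          using F by (intro nn_integral_mono) (auto split: split_indicator)
        with N have "?N < \<infinity>" by (rule le_less_trans[rotated])
        then obtain \<alpha> where \<alpha>: "0 \<le> \<alpha>" "?N = ennreal \<alpha>"
          by (cases ?N) auto
        have "ennreal ((1 - \<epsilon>) * t * \<alpha>) \<le> emeasure (distr M borel (running_sup X t)) F"
        proof (rule running_sup_closed_ge[OF t(1) F(1)])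
          show "ennreal ((1 - \<epsilon>) * t * \<alpha>) \<le> chain lindley (law (t / real (Suc n))) (Suc n) (indicator F) 0" for n
            using grid(1)[OF \<open>F \<in> sets borel\<close> F(2), of n] \<epsilon> t \<alpha> by (simp add: ennreal_mult)
        qed (use \<epsilon> t \<alpha> in auto)
        then show "(\<integral>\<^sup>+ x\<in>F. ennreal ((1 - \<epsilon>) * t * \<nu> x) \<partial>lborel)
            \<le> emeasure (distr M borel (running_sup X t)) F"
          using \<epsilon> t \<alpha> \<open>F \<in> sets borel\<close> by (subst cmult) (auto simp: ennreal_mult)
      qed (use \<epsilon> t \<nu>_nonneg in auto)
      ultimately show ?thesis
        by eventually_elim (auto simp: algebra_simps abs_le_iff)
    qed
    \<comment> \<open>Open windows of length 2 at unit distance overlap, so countably many of them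
      cover everything beyond \<open>K + 1\<close>.\<close>
    have "AE x in lborel. \<forall>j :: nat. x \<in> {K + real j<..<K + real j + 2} \<longrightarrow>
        \<bar>f x - t * \<nu> x\<bar> \<le> \<epsilon> * (t * \<nu> x)"
      unfolding AE_all_countable by (intro allI local) auto
    then show "AE x in lborel. K + 1 < x \<longrightarrow> \<bar>f x - t * \<nu> x\<bar> \<le> \<epsilon> * (t * \<nu> x)"
    proof eventually_elim
      case (elim x)
      show ?case
      proof
        assume "K + 1 < x"
        \<comment> \<open>With j the integer part of \<open>x - K - 1\<close>, x lies in
          \<open>[K + j + 1, K + j + 2)\<close>, inside the j-th window.\<close>
        then have "x \<in> {K + real (nat \<lfloor>x - K - 1\<rfloor>)<..<K + real (nat \<lfloor>x - K - 1\<rfloor>) + 2}"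
          by auto linarith+
        with elim show "\<bar>f x - t * \<nu> x\<bar> \<le> \<epsilon> * (t * \<nu> x)" by blast
      qed
    qed
  qed (use K in auto)
qed

end

(* f t is an arbitrary version of the density of the running supremum. A pointwise limit is not
   invariant under a change of version, so the conclusion is about a suitable version g t of f t. *)
theorem theorem3p7:
  fixes M :: "'a measure" and X :: "real \<Rightarrow> 'a \<Rightarrow> real"
    and L :: "real measure" and \<nu> :: "real \<Rightarrow> real"
    and p f :: "real \<Rightarrow> real \<Rightarrow> real" and t0 :: real
  assumes levy: "levy_process M X"
    and not_cpp: "\<not> compound_poisson_process M X"
    and not_sub: "\<not> subordinator M (\<lambda>t \<omega>. \<bar>X t \<omega>\<bar>)"
    and p: "\<And>t. 0 < t \<Longrightarrow> has_density_on (distr M borel (X t)) {0..} (p t)"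
    and L: "is_levy_measure M X L"
    and \<nu>: "has_density_on L {0<..} \<nu>"
    and f: "\<And>t. 0 < t \<Longrightarrow> has_density_on (distr M borel (running_sup X t)) {0<..} (f t)"
    and doubling: "\<And>r. 0 < r \<Longrightarrow>
      \<exists>c>0. (\<forall>x y. r < x \<and> x < y \<longrightarrow> \<nu> y \<le> c * \<nu> x) \<and> (\<forall>x>r. \<nu> x \<le> c * \<nu> (2 * x))"
    and long_tail: "\<exists>x0>0. \<forall>a>x0. ((\<lambda>x. \<nu> (x + a) / \<nu> x) \<longlongrightarrow> 1) at_top"
    and t0: "0 < t0"
    and p_lim: "uniform_limit {0<..t0} (\<lambda>x t. p t x / (t * \<nu> x)) (\<lambda>t. 1) at_top"
  shows "\<exists>g :: real \<Rightarrow> real \<Rightarrow> real.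
    (\<forall>t>0. has_density_on (distr M borel (running_sup X t)) {0<..} (g t) \<and>
            (AE x in lborel. 0 < x \<longrightarrow> g t x = f t x)) \<and>
    uniform_limit {0<..t0} (\<lambda>x t. g t x / \<nu> x) (\<lambda>t. t) at_top \<and>
    ((\<exists>xs>0. antimono_on {xs<..} \<nu>) \<longrightarrow>
       uniform_limit {0<..t0} (\<lambda>x t. g t x / (t * \<nu> x)) (\<lambda>t. 1) at_top)"
proof -
  interpret levy_process M X by fact
  \<comment> \<open>Measurability and sign of \<nu> are known on (0, \<infinity>) only; n is a
    global function that agrees with \<nu> there.\<close>
  define n where "n x = indicator {0<..} x * \<nu> x" for x
  have n_eq: "n x = \<nu> x" if "0 < x" for x using that by (simp add: n_def)
  have n_meas [measurable]: "n \<in> borel_measurable borel"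
    using \<nu> by (simp add: n_def[abs_def] has_density_on_def set_borel_measurable_def)
  have n_nonneg: "0 \<le> n x" for x
    using \<nu> by (auto simp: n_def has_density_on_def indicator_def)
  have ev: "eventually (\<lambda>x. n x = \<nu> x) at_top"
    using eventually_gt_at_top[of 0] by eventually_elim (rule n_eq)
  obtain x0 where x0: "0 < x0" "\<And>a. x0 < a \<Longrightarrow> ((\<lambda>x. \<nu> (x + a) / \<nu> x) \<longlongrightarrow> 1) at_top"
    using long_tail by auto
  have n_lim: "((\<lambda>x. n (x + a) / n x) \<longlongrightarrow> 1) at_top" if "x0 < a" for a
  proof (rule Lim_transform_eventually[OF x0(2)[OF that]])
    show "eventually (\<lambda>x. \<nu> (x + a) / \<nu> x = n (x + a) / n x) at_top"
      using eventually_gt_at_top[of 0] by eventually_elim (use that x0 in \<open>simp add: n_eq\<close>)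
  qed
  have shift: "\<exists>K. \<forall>x\<ge>K. 0 < n x \<and>
      (\<forall>u. \<bar>u\<bar> \<le> R \<longrightarrow> (1 - d) * n x \<le> n (x + u) \<and> n (x + u) \<le> (1 + d) * n x)" if "0 < R" "0 < d" for R d
    using uniform_shift_ratio[of n x0 R d] n_lim n_nonneg that by simp
  have n_pos: "eventually (\<lambda>x. 0 < n x) at_top"
    using shift[of 1 1] by (auto simp: eventually_at_top_linorder)
  have "regular_tail_semigroup law n t0"
  proof (rule regular_tail_semigroup.intro)
    show "\<exists>K. \<forall>t\<in>{0<..t0}. \<forall>\<phi>\<in>borel_measurable borel. (\<forall>x\<le>K. \<phi> x = 0) \<longrightarrow>
      ennreal ((1 - d) * t) * (\<integral>\<^sup>+ x. \<phi> x * ennreal (n x) \<partial>lborel) \<le> (\<integral>\<^sup>+ x. \<phi> x \<partial>law t) \<and>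
      (\<integral>\<^sup>+ x. \<phi> x \<partial>law t) \<le> ennreal ((1 + d) * t) * (\<integral>\<^sup>+ x. \<phi> x * ennreal (n x) \<partial>lborel)"
      if "0 < d" for d
    proof (rule law_tail[OF p n_meas n_pos _ that])
      show "uniform_limit {0<..t0} (\<lambda>x t. p t x / (t * n x)) (\<lambda>t. 1) at_top"
      proof (subst uniform_limit_cong)
        show "eventually (\<lambda>x. \<forall>t\<in>{0<..t0}. p t x / (t * n x) = p t x / (t * \<nu> x)) at_top"
          using ev by eventually_elim simp
      qed (auto intro: p_lim)
    qed
    obtain c where c: "0 < c" "\<forall>x y. 1 < x \<and> x < y \<longrightarrow> \<nu> y \<le> c * \<nu> x" "\<forall>x>1. \<nu> x \<le> c * \<nu> (2 * x)"
      using doubling[of 1] by auto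
    show "\<exists>C\<ge>1. \<forall>x y. 4 < x \<longrightarrow> x / 4 \<le> y \<longrightarrow> n y \<le> C * n x"
      by (rule doubling_comparable[OF n_nonneg c(1)]) (use c in \<open>auto simp: n_eq\<close>)
    show "\<exists>K. \<forall>x\<ge>K. \<forall>u. \<bar>u\<bar> \<le> R \<longrightarrow> (1 - d) * n x \<le> n (x + u) \<and> n (x + u) \<le> (1 + d) * n x"
      if "0 < R" "0 < d" for R d
      using shift[OF that] by blast
  qed (fact t0 n_meas n_nonneg prob_space_law walk_eq_law law_tight lindley_tight_law sets_distr)+
  note bounds = running_sup_density_bounds[OF this]
  \<comment> \<open>Countably many accuracies: for each t the union of all exceptional sets is still
    null.\<close>
  define \<epsilon> where "\<epsilon> k = 1 / real (Suc k)" for k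
  have \<epsilon>: "0 < \<epsilon> k" "\<epsilon> k \<le> 1" for k by (auto simp: \<epsilon>_def)
  have "\<exists>K. 0 < K \<and> (\<forall>t. 0 < t \<longrightarrow> t \<le> t0 \<longrightarrow>
      (AE x in lborel. K < x \<longrightarrow> \<bar>f t x - t * n x\<bar> \<le> \<epsilon> k * (t * n x)))" for k
  proof -
    obtain K where "0 < K" and K: "\<forall>t f. 0 < t \<longrightarrow> t \<le> t0 \<longrightarrow>
        has_density_on (distr M borel (running_sup X t)) {0<..} f \<longrightarrow>
        (AE x in lborel. K < x \<longrightarrow> \<bar>f x - t * n x\<bar> \<le> \<epsilon> k * (t * n x))"
      using bounds[OF \<epsilon>[of k]] by (elim exE conjE)
    show ?thesis
      by (intro exI[of _ K] conjI allI impI \<open>0 < K\<close> K[rule_format] f)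
  qed
  then have "\<forall>k. \<exists>K. 0 < K \<and> (\<forall>t. 0 < t \<longrightarrow> t \<le> t0 \<longrightarrow>
      (AE x in lborel. K < x \<longrightarrow> \<bar>f t x - t * n x\<bar> \<le> \<epsilon> k * (t * n x)))" ..
  from choice[OF this] obtain K where K: "\<And>k. 0 < K k" "\<And>k t. 0 < t \<Longrightarrow> t \<le> t0 \<Longrightarrow>
      AE x in lborel. K k < x \<longrightarrow> \<bar>f t x - t * n x\<bar> \<le> \<epsilon> k * (t * n x)"
    by blast
  define G where "G t x \<longleftrightarrow> (\<forall>k. K k < x \<longrightarrow> \<bar>f t x - t * n x\<bar> \<le> \<epsilon> k * (t * n x))" for t x
  \<comment> \<open>On the exceptional set the value \<open>t * n x\<close> meets every bound
    exactly. For each t this alters f t on a null set only, and the thresholds \<open>K k\<close>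
    are common to all t, so the pointwise limits of g become uniform.\<close>
  define g where "g t x = (if t \<le> t0 \<and> \<not> G t x then t * n x else f t x)" for t x
  have AE_G: "AE x in lborel. G t x" if "0 < t" "t \<le> t0" for t
    unfolding G_def AE_all_countable using K(2)[OF that] by simp
  have g_eq: "AE x in lborel. g t x = f t x" if "0 < t" for t
  proof (cases "t \<le> t0")
    case True
    show ?thesis using AE_G[OF that True] by eventually_elim (simp add: g_def)
  qed (simp add: g_def)
  have g_dens: "has_density_on (distr M borel (running_sup X t)) {0<..} (g t)" if "0 < t" for t
  proof (rule has_density_on_cong_AE[OF f[OF that]])
    \<comment> \<open>Measurability of f t is known on (0, \<infinity>) only, so G is replaced by a
      version G' built from the cut-off f', with the same value for x > 0.\<close>
    define f' where "f' x = indicator {0<..} x * f t x" for x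
    have [measurable]: "f' \<in> borel_measurable borel"
      using f[OF that] by (simp add: f'_def[abs_def] has_density_on_def set_borel_measurable_def)
    define G' where "G' x \<longleftrightarrow> (\<forall>k. K k < x \<longrightarrow> \<bar>f' x - t * n x\<bar> \<le> \<epsilon> k * (t * n x))" for x
    have [measurable]: "Measurable.pred borel G'"
      unfolding G'_def[abs_def] by measurable
    have "(\<lambda>x. indicator {0<..} x * (if t \<le> t0 \<and> \<not> G' x then t * n x else f' x)) \<in> borel_measurable borel"
      by measurable
    also have "(\<lambda>x. indicator {0<..} x * (if t \<le> t0 \<and> \<not> G' x then t * n x else f' x))
        = (\<lambda>x. indicator {0<..} x *\<^sub>R g t x)"
    proof
      fix x
      show "indicator {0<..} x * (if t \<le> t0 \<and> \<not> G' x then t * n x else f' x) = indicator {0<..} x *\<^sub>R g t x"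
      proof (cases "0 < x")
        case True
        then have "G' x = G t x" by (simp add: G_def G'_def f'_def)
        with True show ?thesis by (simp add: g_def f'_def)
      qed simp
    qed
    finally show "set_borel_measurable borel {0<..} (g t)"
      by (simp add: set_borel_measurable_def)
    show "0 \<le> g t x" if "x \<in> {0<..}" for x
      using f[OF \<open>0 < t\<close>] that \<open>0 < t\<close> n_nonneg[of x] by (auto simp: g_def has_density_on_def)
    show "AE x in lborel. x \<in> {0<..} \<longrightarrow> g t x = f t x"
      using g_eq[OF that] by eventually_elim simp
  qed
  have ratio: "eventually (\<lambda>x. \<forall>t\<in>{0<..t0}. \<bar>g t x / (t * \<nu> x) - 1\<bar> < e \<and> 0 < \<nu> x) at_top" if "0 < e" for e
  proof -
    obtain k where k: "\<epsilon> k < e"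
      using reals_Archimedean[OF \<open>0 < e\<close>] by (auto simp: \<epsilon>_def inverse_eq_divide)
    show ?thesis
      using eventually_gt_at_top[of "K k"] n_pos ev
    proof eventually_elim
      case (elim x)
      show ?case
      proof (intro ballI conjI)
        fix t assume t: "t \<in> {0<..t0}"
        have pos: "0 < t * \<nu> x" using elim t by auto
        have "\<bar>g t x - t * \<nu> x\<bar> \<le> \<epsilon> k * (t * \<nu> x)"
          using elim t pos \<epsilon>(1)[of k] by (auto simp: g_def G_def)
        also have "\<dots> < e * (t * \<nu> x)" using k pos by (rule mult_strict_right_mono)
        finally have "\<bar>g t x - t * \<nu> x\<bar> / (t * \<nu> x) < e" using pos by (simp only: pos_divide_less_eq)
        moreover have "g t x / (t * \<nu> x) - 1 = (g t x - t * \<nu> x) / (t * \<nu> x)"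
          by (simp only: diff_divide_distrib divide_self[OF less_imp_neq[OF pos, symmetric]])
        then have "\<bar>g t x / (t * \<nu> x) - 1\<bar> = \<bar>g t x - t * \<nu> x\<bar> / (t * \<nu> x)"
          by (simp only: abs_divide abs_of_pos[OF pos])
        ultimately show "\<bar>g t x / (t * \<nu> x) - 1\<bar> < e" by simp
        show "0 < \<nu> x" using elim by simp
      qed
    qed
  qed
  have "uniform_limit {0<..t0} (\<lambda>x t. g t x / (t * \<nu> x)) (\<lambda>t. 1) at_top"
    unfolding uniform_limit_iff dist_real_def
  proof (intro allI impI)
    fix e :: real assume "0 < e"
    show "eventually (\<lambda>x. \<forall>t\<in>{0<..t0}. \<bar>g t x / (t * \<nu> x) - 1\<bar> < e) at_top"
      using ratio[OF \<open>0 < e\<close>] by eventually_elim blast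
  qed
  moreover have "uniform_limit {0<..t0} (\<lambda>x t. g t x / \<nu> x) (\<lambda>t. t) at_top"
    unfolding uniform_limit_iff dist_real_def
  proof (intro allI impI)
    fix e :: real assume "0 < e"
    \<comment> \<open>The absolute error is t times the relative one, and t is at most
      \<open>t0\<close>.\<close>
    then have "0 < e / t0" using t0 by simp
    show "eventually (\<lambda>x. \<forall>t\<in>{0<..t0}. \<bar>g t x / \<nu> x - t\<bar> < e) at_top"
      using ratio[OF \<open>0 < e / t0\<close>]
    proof eventually_elim
      case (elim x)
      show ?case
      proof
        fix t assume t: "t \<in> {0<..t0}"
        then have *: "\<bar>g t x / (t * \<nu> x) - 1\<bar> < e / t0" "0 < \<nu> x" using elim by auto
        have "g t x / \<nu> x - t = t * (g t x / (t * \<nu> x) - 1)"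
          using t * by (simp add: field_simps)
        then have "\<bar>g t x / \<nu> x - t\<bar> = t * \<bar>g t x / (t * \<nu> x) - 1\<bar>"
          using t by (simp add: abs_mult)
        also have "\<dots> < t * (e / t0)" using t * by (intro mult_strict_left_mono) auto
        also have "\<dots> \<le> t0 * (e / t0)" using t \<open>0 < e\<close> t0 by (intro mult_right_mono) auto
        finally show "\<bar>g t x / \<nu> x - t\<bar> < e" using t0 by simp
      qed
    qed
  qed
  moreover have "\<forall>t>0. has_density_on (distr M borel (running_sup X t)) {0<..} (g t) \<and>
      (AE x in lborel. 0 < x \<longrightarrow> g t x = f t x)"
  proof (intro allI impI conjI)
    fix t :: real assume "0 < t"
    then show "has_density_on (distr M borel (running_sup X t)) {0<..} (g t)" by (rule g_dens)
    show "AE x in lborel. 0 < x \<longrightarrow> g t x = f t x"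
      using g_eq[OF \<open>0 < t\<close>] by eventually_elim simp
  qed
  ultimately show ?thesis by (intro exI[of _ g]) blast
qed

end
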